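(* Let $p^s,p^t$ be the empirical source and target data distributions and for $t\in[0,1]$ let $p(x,t)=(1-t)\,p^s(x)+t\,p^t(x)$. Let $t\mapsto(\lambda(t),\gamma(t))$ be a smooth path with velocities $(\dot\lambda,\dot\gamma)$, and let $t\mapsto\theta(t)$ be a smooth path with $\theta(t)$ in the equilibrium set $\Theta_{\lambda(t),\gamma(t)}$ for the data distribution $p(\cdot,t)$, satisfying the quasi-static condition $\frac{d}{dt}\nabla_\theta J(\theta(t),\lambda(t),\gamma(t),t)=0$. Assume $A=\nabla_\theta^2J$ is invertible along the path. Then $$\dot\theta=\theta_\lambda\dot\lambda+\theta_\gamma\dot\gamma+\theta_t,$$ where $$\theta_t=A^{-1}b_t=-A^{-1}\int\frac{\partial p(x,t)}{\partial t}\,\langle\nabla_\theta H\rangle\,dx,\qquad\theta_\lambda=A^{-1}b_\lambda,\qquad\theta_\gamma=A^{-1}b_\gamma,$$ $$A=\mathbb{E}_{x\sim p(x,t)}\Big[\langle\nabla_\theta^2H\rangle+\langle\nabla_\theta H\rangle\langle\nabla_\theta H\rangle^\top-\langle\nabla_\theta H\,\nabla_\theta^\top H\rangle\Big],$$ $$b_\lambda=-\mathbb{E}_{x\sim p(x,t)}\Big[\Big\langle\frac{\partial\nabla_\theta H}{\partial\lambda}\Big\rangle-\Big\langle\frac{\partial H}{\partial\lambda}\nabla_\theta H\Big\rangle+\Big\langle\frac{\partial H}{\partial\lambda}\Big\rangle\langle\nabla_\theta H\rangle\Big],$$ $$b_\gamma=-\mathbb{E}_{x\sim p(x,t)}\Big[\Big\langle\frac{\partial\nabla_\theta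 H}{\partial\gamma}\Big\rangle-\Big\langle\frac{\partial H}{\partial\gamma}\nabla_\theta H\Big\rangle+\Big\langle\frac{\partial H}{\partial\gamma}\Big\rangle\langle\nabla_\theta H\rangle\Big].$$
   Context: The source and target samples are $x^s_1,\dots,x^s_{n_s}$ and $x^t_1,\dots,x^t_{n_t}$, in the same input domain, with $p^s(x)=\frac1{n_s}\sum_{i}\delta_{x-x^s_i}$ and $p^t(x)=\frac1{n_t}\sum_i\delta_{x-x^t_i}$ (the superscript $t$ means "target"; elsewhere $t\in[0,1]$ is time). Thus $\partial p(x,t)/\partial t=p^t-p^s$ as a signed measure. Each datum $x$ has a fixed deterministic label $y_x$, not interpolated. For parameters $\theta\in\Theta\subseteq\mathbb{R}^N$ there are a density $m_\theta(z)$ on latent codes $z$, a decoder density $d_\theta(x|z)$ and a classifier $c_\theta(y|z)$, all positive and smooth in $\theta$. The Hamiltonian is $$H(z;x,\theta,\lambda,\gamma)=-\log m_\theta(z)-\lambda\log d_\theta(x|z)-\gamma\log c_\theta(y_x|z),$$ and $Z_{\theta,x}=\int e^{-H}dz$, assumed finite. Define $J(\theta,\lambda,\gamma,t)=-\mathbb{E}_{x\sim p(x,t)}[\log Z_{\theta,x}]$; the equilibrium set for the data distribution $p(\cdot,t)$ is the set $\Theta_{\lambda,\gamma}$ of minimizers of $J(\cdot,\lambda,\gamma,t)$ over $\Theta$, on which $\nabla_\theta J=0$. For fixed $x$, $\langle\varphi\rangle=\int\varphi\,e^{-H}dz\big/\int e^{-H}dz$ is the Gibbs average over $z$. Enough regularity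 and integrability is assumed to differentiate under the integral over $z$. *)

theory Defs
  imports "HOL-Probability.Probability"
begin

text \<open>
  \<open>D [v\<^sub>1, \<dots>, v\<^sub>k]\<close> is the iterated directional derivative of \<open>f\<close> along \<open>v\<^sub>k\<close>, \dots, \<open>v\<^sub>1\<close>. On open
  sets and on nondegenerate real intervals (one-sided derivatives at the end points) derivatives
  within \<open>S\<close> are unique and this is the usual \<open>C\<^sup>\<infinity>\<close> notion.
\<close>
definition smooth_on :: "'a::euclidean_space set \<Rightarrow> ('a \<Rightarrow> 'b::real_normed_vector) \<Rightarrow> bool" where
  "smooth_on S f \<longleftrightarrow>
     (\<exists>D :: 'a list \<Rightarrow> 'a \<Rightarrow> 'b.
        (\<forall>x\<in>S. D [] x = f x) \<and>
        (\<forall>vs. \<forall>x\<in>S. (D vs has_derivative (\<lambda>v. D (v # vs) x)) (at x within S)))"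

definition grad :: "(real^'n \<Rightarrow> real) \<Rightarrow> real^'n \<Rightarrow> real^'n" where
  "grad f x = (\<chi> i. frechet_derivative f (at x) (axis i 1))"

definition hessian :: "(real^'n \<Rightarrow> real) \<Rightarrow> real^'n \<Rightarrow> real^'n^'n" where
  "hessian f x = jacobian (grad f) (at x)"

definition outer :: "real^'n \<Rightarrow> real^'n \<Rightarrow> real^'n^'n" where
  "outer v w = (\<chi> i j. v $ i * w $ j)"

definition empirical :: "nat \<Rightarrow> (nat \<Rightarrow> 'x) \<Rightarrow> 'x pmf" where
  "empirical n xs = map_pmf xs (pmf_of_set {1..n})"

text \<open>
  The data distributions are finite sums of point masses. They are represented by their mass
  functions, so that \<open>\<integral> q(x) f(x) dx\<close> against such a (possibly signed) \<open>q\<close> is the integral of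
  \<open>q x *\<^sub>R f x\<close> with respect to counting measure.
\<close>
definition data_mass :: "'x pmf \<Rightarrow> 'x pmf \<Rightarrow> 'x \<Rightarrow> real \<Rightarrow> real" where
  "data_mass ps pt x t = (1 - t) * pmf ps x + t * pmf pt x"

definition mass_integral ::
    "('x \<Rightarrow> real) \<Rightarrow> ('x \<Rightarrow> 'b::{banach, second_countable_topology}) \<Rightarrow> 'b" where
  "mass_integral q f = (\<integral>x. q x *\<^sub>R f x \<partial>count_space UNIV)"

definition hamiltonian ::
    "(real^'n \<Rightarrow> 'z \<Rightarrow> real) \<Rightarrow> (real^'n \<Rightarrow> 'x \<Rightarrow> 'z \<Rightarrow> real) \<Rightarrow> (real^'n \<Rightarrow> 'y \<Rightarrow> 'z \<Rightarrow> real) \<Rightarrow> ('x \<Rightarrow> 'y)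
      \<Rightarrow> 'x \<Rightarrow> real^'n \<Rightarrow> real \<Rightarrow> real \<Rightarrow> 'z \<Rightarrow> real" where
  "hamiltonian m d c lab x \<theta> l g z =
     - ln (m \<theta> z) - l * ln (d \<theta> x z) - g * ln (c \<theta> (lab x) z)"

definition partition_fun :: "('z::euclidean_space \<Rightarrow> real) \<Rightarrow> real" where
  "partition_fun h = (\<integral>z. exp (- h z) \<partial>lborel)"

definition gibbs ::
    "('z::euclidean_space \<Rightarrow> real) \<Rightarrow> ('z \<Rightarrow> 'b::{banach, second_countable_topology}) \<Rightarrow> 'b" where
  "gibbs h \<phi> = (\<integral>z. exp (- h z) *\<^sub>R \<phi> z \<partial>lborel) /\<^sub>R partition_fun h"

definition free_energy ::
    "('x \<Rightarrow> real \<Rightarrow> real) \<Rightarrow> ('x \<Rightarrow> real^'n \<Rightarrow> real \<Rightarrow> real \<Rightarrow> 'z::euclidean_space \<Rightarrow> real)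
      \<Rightarrow> real^'n \<Rightarrow> real \<Rightarrow> real \<Rightarrow> real \<Rightarrow> real" where
  "free_energy p H \<theta> l g t = - mass_integral (\<lambda>x. p x t) (\<lambda>x. ln (partition_fun (H x \<theta> l g)))"

definition equilibrium_set ::
    "(real^'n) set \<Rightarrow> (real^'n \<Rightarrow> real \<Rightarrow> real \<Rightarrow> real \<Rightarrow> real) \<Rightarrow> real \<Rightarrow> real \<Rightarrow> real \<Rightarrow> (real^'n) set" where
  "equilibrium_set \<Theta> J l g t = {\<theta>. is_arg_min (\<lambda>\<theta>. J \<theta> l g t) (\<lambda>\<theta>. \<theta> \<in> \<Theta>) \<theta>}"

text \<open>The remaining arguments are \<open>x \<theta> \<lambda> \<gamma> z\<close>, as for the Hamiltonian.\<close>

definition grad_H ::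
    "('x \<Rightarrow> real^'n \<Rightarrow> real \<Rightarrow> real \<Rightarrow> 'z \<Rightarrow> real) \<Rightarrow> 'x \<Rightarrow> real^'n \<Rightarrow> real \<Rightarrow> real \<Rightarrow> 'z \<Rightarrow> real^'n" where
  "grad_H H x \<theta> l g z = grad (\<lambda>\<theta>'. H x \<theta>' l g z) \<theta>"

definition hess_H ::
    "('x \<Rightarrow> real^'n \<Rightarrow> real \<Rightarrow> real \<Rightarrow> 'z \<Rightarrow> real) \<Rightarrow> 'x \<Rightarrow> real^'n \<Rightarrow> real \<Rightarrow> real \<Rightarrow> 'z \<Rightarrow> real^'n^'n" where
  "hess_H H x \<theta> l g z = hessian (\<lambda>\<theta>'. H x \<theta>' l g z) \<theta>"

definition dlam ::
    "('x \<Rightarrow> real^'n \<Rightarrow> real \<Rightarrow> real \<Rightarrow> 'z \<Rightarrow> 'b::real_normed_vector)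
      \<Rightarrow> 'x \<Rightarrow> real^'n \<Rightarrow> real \<Rightarrow> real \<Rightarrow> 'z \<Rightarrow> 'b" where
  "dlam F x \<theta> l g z = vector_derivative (\<lambda>l'. F x \<theta> l' g z) (at l)"

definition dgam ::
    "('x \<Rightarrow> real^'n \<Rightarrow> real \<Rightarrow> real \<Rightarrow> 'z \<Rightarrow> 'b::real_normed_vector)
      \<Rightarrow> 'x \<Rightarrow> real^'n \<Rightarrow> real \<Rightarrow> real \<Rightarrow> 'z \<Rightarrow> 'b" where
  "dgam F x \<theta> l g z = vector_derivative (\<lambda>g'. F x \<theta> l g' z) (at g)"

text \<open>
  Sufficient condition for differentiating under the integral over \<open>z\<close>, at time \<open>t\<close> of the path
  and for the datum \<open>x\<close>: locally uniformly in \<open>\<theta>\<close> and along the path \<open>s \<mapsto> (\<lambda>(s), \<gamma>(s))\<close>, all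
  integrands occurring in the Gibbs averages have a common integrable bound. Only values of
  \<open>(\<lambda>, \<gamma>)\<close> on the path are involved, so the path may run along the boundary of the region where
  the partition function is finite.
\<close>
definition locally_dominated ::
    "('x \<Rightarrow> real^'n \<Rightarrow> real \<Rightarrow> real \<Rightarrow> 'z::euclidean_space \<Rightarrow> real)
      \<Rightarrow> (real \<Rightarrow> real^'n) \<Rightarrow> (real \<Rightarrow> real) \<Rightarrow> (real \<Rightarrow> real) \<Rightarrow> 'x \<Rightarrow> real \<Rightarrow> bool" where
  "locally_dominated H th lam gam x t \<longleftrightarrow>
     (\<exists>\<epsilon>>0. \<exists>G. integrable lborel G \<and>
        (AE z in lborel. \<forall>\<theta>\<in>ball (th t) \<epsilon>. \<forall>s\<in>ball t \<epsilon> \<inter> {0..1}.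
           let l = lam s; g = gam s;
               w = exp (- H x \<theta> l g z);
               a = norm (grad_H H x \<theta> l g z)
           in w \<le> G z \<and> w * a \<le> G z \<and> w * a\<^sup>2 \<le> G z \<and>
              w * norm (hess_H H x \<theta> l g z) \<le> G z \<and>
              w * \<bar>dlam H x \<theta> l g z\<bar> \<le> G z \<and>
              w * \<bar>dgam H x \<theta> l g z\<bar> \<le> G z \<and>
              w * (\<bar>dlam H x \<theta> l g z\<bar> * a) \<le> G z \<and>
              w * (\<bar>dgam H x \<theta> l g z\<bar> * a) \<le> G z \<and>
              w * norm (dlam (grad_H H) x \<theta> l g z) \<le> G z \<and>
              w * norm (dgam (grad_H H) x \<theta> l g z) \<le> G z))"

end

theory Submission
  imports Defs
begin

text \<open>
  For each datum the Hamiltonian is affine in \<open>(\<lambda>, \<gamma>)\<close>. Dominated convergence gives the derivative of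
  a Gibbs average \<open>\<langle>\<phi>\<rangle>\<close>, when \<open>H\<close> moves with velocity \<open>k\<close> and \<open>\<phi>\<close> with velocity \<open>u\<close>, as
  \<open>\<langle>u\<rangle> - \<langle>k \<phi>\<rangle> + \<langle>k\<rangle> \<langle>\<phi>\<rangle>\<close>. Applied to \<open>\<phi> = \<nabla>H\<close> it is used twice: in \<open>\<theta>\<close> alone, which identifies the
  Hessian \<open>A\<close>, and directly along the path \<open>s \<mapsto> (\<theta>(s), \<lambda>(s), \<gamma>(s))\<close>. The second use avoids joint
  differentiability in \<open>(\<theta>, \<lambda>, \<gamma>)\<close>, which can fail because the partition function need not be finite
  off the path. The velocity formula is linear in \<open>(k, u)\<close>, so the quasi-static condition reads
  \<open>A \<theta>' - \<lambda>' b\<^sub>\<lambda> - \<gamma>' b\<^sub>\<gamma> - b\<^sub>t = 0\<close>.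
\<close>

section \<open>Derivatives of Gibbs averages\<close>

text \<open>Everything is differentiated within a convex set \<open>S\<close>, so that one lemma
  serves two situations: a ball of parameters, where the derivative within \<open>S\<close> is the
  ordinary one, and a short time window inside \<open>{0..1}\<close>, where it is one-sided at the
  end points. Convexity matters because difference quotients are controlled by the mean value
  inequality, which needs the derivative bounded on the whole segment and not only at the base
  point. In the parameter case the gradient of \<open>J\<close> must be known on a neighbourhood of
  \<open>th t\<close>, since the Hessian differentiates it there; hence one majorant is shared by
  all base points of the ball. In the time case the assumed domination has to be converted:
  continuity of \<open>th\<close> keeps the path inside the ball where it holds, and the velocities,
  continuous on a compact interval, are bounded by a constant that multiplies the majorant. The data
  average is a finite sum with time-dependent masses, so it commutes with all derivatives, and the
  product rule on the masses is the source of \<open>b_t\<close>.\<close>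

lemma has_derivative_lebesgue_integral_dominated:
  fixes f :: "'a::real_normed_vector \<Rightarrow> 'c \<Rightarrow> 'b::{banach, second_countable_topology}"
    and f' :: "'a \<Rightarrow> 'c \<Rightarrow> 'a \<Rightarrow> 'b"
  assumes "convex S" and x: "x \<in> S"
    and f: "\<And>y. y \<in> S \<Longrightarrow> integrable M (f y)"
    and f': "\<And>v. (\<lambda>z. f' x z v) \<in> borel_measurable M"
    and G: "integrable M G"
    and dom: "AE z in M. \<forall>y\<in>S. ((\<lambda>y. f y z) has_derivative f' y z) (at y within S) \<and>
                (\<forall>v. norm (f' y z v) \<le> G z * norm v)"
  shows "((\<lambda>y. \<integral>z. f y z \<partial>M) has_derivative (\<lambda>v. \<integral>z. f' x z v \<partial>M)) (at x within S)"
proof -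
  have int': "integrable M (\<lambda>z. f' x z v)" for v
    by (rule Bochner_Integration.integrable_bound[OF integrable_mult_left[OF G, of "norm v"] f'])
      (use dom in eventually_elim, use x in \<open>auto intro: order_trans[OF _ abs_ge_self]\<close>)
  \<comment> \<open>\<open>f' x z\<close> is a derivative, hence linear, only for almost every
    \<open>z\<close>; additivity and homogeneity are therefore transferred by almost-everywhere
    equality of the integrands.\<close>
  have "bounded_linear (\<lambda>v. \<integral>z. f' x z v \<partial>M)"
  proof (rule bounded_linear_intro)
    fix u v
    have "(\<integral>z. f' x z (u + v) \<partial>M) = (\<integral>z. f' x z u + f' x z v \<partial>M)"
      by (rule integral_cong_AE)
        (use dom f' x in \<open>auto dest!: has_derivative_linear linear_add\<close>)
    then show "(\<integral>z. f' x z (u + v) \<partial>M) = (\<integral>z. f' x z u \<partial>M) + (\<integral>z. f' x z v \<partial>M)"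
      using int' by simp
  next
    fix r v
    have "(\<integral>z. f' x z (r *\<^sub>R v) \<partial>M) = (\<integral>z. r *\<^sub>R f' x z v \<partial>M)"
      by (rule integral_cong_AE)
        (use dom f' x in \<open>auto dest!: has_derivative_linear linear_scale\<close>)
    then show "(\<integral>z. f' x z (r *\<^sub>R v) \<partial>M) = r *\<^sub>R (\<integral>z. f' x z v \<partial>M)"
      by simp
  next
    fix v
    have "norm (\<integral>z. f' x z v \<partial>M) \<le> (\<integral>z. norm (f' x z v) \<partial>M)"
      by (rule integral_norm_bound)
    also have "\<dots> \<le> (\<integral>z. G z * norm v \<partial>M)"
      by (rule integral_mono_AE) (use int' G dom x in auto)
    finally show "norm (\<integral>z. f' x z v \<partial>M) \<le> norm v * (\<integral>z. G z \<partial>M)"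
      by (simp add: mult.commute)
  qed
  moreover have "((\<lambda>y. (1 / norm (y - x)) *\<^sub>R
      ((\<integral>z. f y z \<partial>M) - ((\<integral>z. f x z \<partial>M) + (\<integral>z. f' x z (y - x) \<partial>M)))) \<longlongrightarrow> 0) (at x within S)"
    unfolding tendsto_at_iff_sequentially comp_def
  proof (intro allI impI)
    fix X assume X: "\<forall>i. X i \<in> S - {x}" "X \<longlonglongrightarrow> x"
    \<comment> \<open>Dominated convergence concerns sequences, so the limit is tested along an
      arbitrary \<open>X\<close>; \<open>q n\<close> is the normalised first-order
      remainder.\<close>
    define q where "q n z = (1 / norm (X n - x)) *\<^sub>R (f (X n) z - (f x z + f' x z (X n - x)))" for n z
    have q: "integrable M (q n)" for n
      unfolding q_def using f X(1) x int' by auto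
    have "(\<lambda>n. integral\<^sup>L M (q n)) \<longlonglongrightarrow> integral\<^sup>L M (\<lambda>z. 0)"
    proof (rule integral_dominated_convergence)
      \<comment> \<open>One \<open>G z\<close> bounds the increment of \<open>f\<close>, by the mean
        value inequality, the other its linear part.\<close>
      show "integrable M (\<lambda>z. 2 * G z)" using G by simp
      show "q n \<in> borel_measurable M" for n using q by auto
      show "AE z in M. (\<lambda>n. q n z) \<longlonglongrightarrow> 0"
        using dom
      proof eventually_elim
        case (elim z)
        then have "((\<lambda>y. f y z) has_derivative f' x z) (at x within S)" using x by auto
        then have "((\<lambda>y. (1 / norm (y - x)) *\<^sub>R (f y z - (f x z + f' x z (y - x)))) \<longlongrightarrow> 0) (at x within S)"
          unfolding has_derivative_within by auto
        then show ?case
          using X unfolding tendsto_at_iff_sequentially comp_def q_def by blast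
      qed
      show "AE z in M. norm (q n z) \<le> 2 * G z" for n
        using dom
      proof eventually_elim
        case (elim z)
        have ne: "norm (X n - x) > 0" using X(1) by auto
        \<comment> \<open>\<open>onorm_bound\<close> requires \<open>0 \<le> G z\<close>, which the
          bound on \<open>f'\<close> forces at the nonzero vector \<open>X n - x\<close>.\<close>
        have "norm (f' x z (X n - x)) \<le> G z * norm (X n - x)" using elim x by blast
        then have "0 \<le> G z * norm (X n - x)" using norm_ge_zero order_trans by blast
        then have "0 \<le> G z" using ne by (simp add: zero_le_mult_iff)
        then have "onorm (f' y z) \<le> G z" if "y \<in> S" for y
          using elim that by (intro onorm_bound) auto
        then have "norm (f (X n) z - f x z) \<le> G z * norm (X n - x)"
          using elim X(1) x by (intro differentiable_bound[OF \<open>convex S\<close>, where f' = "\<lambda>y. f' y z"]) auto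
        moreover have "norm (f' x z (X n - x)) \<le> G z * norm (X n - x)" using elim x by auto
        ultimately have "norm (f (X n) z - (f x z + f' x z (X n - x))) \<le> 2 * G z * norm (X n - x)"
          using norm_triangle_ineq4[of "f (X n) z - f x z" "f' x z (X n - x)"]
          by (simp add: diff_diff_eq)
        then show ?case using ne by (simp add: q_def divide_simps)
      qed
    qed simp
    moreover have "integral\<^sup>L M (q n) = (1 / norm (X n - x)) *\<^sub>R
        ((\<integral>z. f (X n) z \<partial>M) - ((\<integral>z. f x z \<partial>M) + (\<integral>z. f' x z (X n - x) \<partial>M)))" for n
      unfolding q_def using f X(1) x int' by auto
    ultimately show "(\<lambda>n. (1 / norm (X n - x)) *\<^sub>R
        ((\<integral>z. f (X n) z \<partial>M) - ((\<integral>z. f x z \<partial>M) + (\<integral>z. f' x z (X n - x) \<partial>M)))) \<longlonglongrightarrow> 0"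
      by simp
  qed
  ultimately show "((\<lambda>y. \<integral>z. f y z \<partial>M) has_derivative (\<lambda>v. \<integral>z. f' x z v \<partial>M)) (at x within S)"
    unfolding has_derivative_within by blast
qed

text \<open>An integrable nonnegative function has integral zero only if it vanishes almost
  everywhere; \<open>exp\<close> never vanishes, and Lebesgue measure is not null.\<close>

lemma partition_fun_pos:
  assumes "integrable lborel (\<lambda>z. exp (- h z))"
  shows "0 < partition_fun h"
proof -
  have "partition_fun h \<noteq> 0"
    unfolding partition_fun_def
    using assms by (subst integral_nonneg_eq_0_iff_AE) (auto simp: eventually_False ae_filter_eq_bot_iff)
  moreover have "0 \<le> partition_fun h" by (simp add: partition_fun_def)
  ultimately show ?thesis by simp
qed

text \<open>
  The derivative of \<open>gibbs h \<phi>\<close> along a direction in which \<open>h\<close> has derivative \<open>k\<close> and \<open>\<phi>\<close> has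
  derivative \<open>u\<close>.
\<close>
definition gibbs_response ::
    "('z::euclidean_space \<Rightarrow> real) \<Rightarrow> ('z \<Rightarrow> real) \<Rightarrow> ('z \<Rightarrow> 'b) \<Rightarrow> ('z \<Rightarrow> 'b) \<Rightarrow> 'b::{banach, second_countable_topology}" where
  "gibbs_response h k u \<phi> = gibbs h u - gibbs h (\<lambda>z. k z *\<^sub>R \<phi> z) + gibbs h k *\<^sub>R gibbs h \<phi>"

text \<open>The bounds majorise the numerator and denominator integrands of a Gibbs average and each
  term that the product rule produces from them. They are demanded at every point of
  \<open>S\<close>, because the mean value inequality runs along segments, whereas measurability of
  the derivatives is demanded only at \<open>x\<close>, where they are integrated.\<close>

locale dominated_gibbs_family =
  fixes S :: "'a::real_normed_vector set" and x :: 'a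
    and h :: "'a \<Rightarrow> 'z::euclidean_space \<Rightarrow> real" and h' :: "'a \<Rightarrow> 'z \<Rightarrow> 'a \<Rightarrow> real"
    and \<phi> :: "'a \<Rightarrow> 'z \<Rightarrow> 'b::{banach, second_countable_topology}" and \<phi>' :: "'a \<Rightarrow> 'z \<Rightarrow> 'a \<Rightarrow> 'b"
    and G :: "'z \<Rightarrow> real"
  assumes S: "convex S" "x \<in> S"
    and h[measurable]: "\<And>y. y \<in> S \<Longrightarrow> h y \<in> borel_measurable lborel"
    and \<phi>[measurable]: "\<And>y. y \<in> S \<Longrightarrow> \<phi> y \<in> borel_measurable lborel"
    and h'[measurable]: "\<And>v. (\<lambda>z. h' x z v) \<in> borel_measurable lborel"
    and \<phi>'[measurable]: "\<And>v. (\<lambda>z. \<phi>' x z v) \<in> borel_measurable lborel"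
    and G: "integrable lborel G"
    and dom: "AE z in lborel. \<forall>y\<in>S.
        ((\<lambda>y. h y z) has_derivative h' y z) (at y within S) \<and>
        ((\<lambda>y. \<phi> y z) has_derivative \<phi>' y z) (at y within S) \<and>
        exp (- h y z) \<le> G z \<and> exp (- h y z) * norm (\<phi> y z) \<le> G z \<and>
        (\<forall>v. exp (- h y z) * \<bar>h' y z v\<bar> \<le> G z * norm v \<and>
             exp (- h y z) * norm (\<phi>' y z v) \<le> G z * norm v \<and>
             exp (- h y z) * (\<bar>h' y z v\<bar> * norm (\<phi> y z)) \<le> G z * norm v)"
begin

lemma integrable_weight: "y \<in> S \<Longrightarrow> integrable lborel (\<lambda>z. exp (- h y z))"
  by (rule Bochner_Integration.integrable_bound[OF G])
    (measurable, use dom in eventually_elim, force intro: order_trans[OF _ abs_ge_self])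

lemma integrable_weight_observable: "y \<in> S \<Longrightarrow> integrable lborel (\<lambda>z. exp (- h y z) *\<^sub>R \<phi> y z)"
  by (rule Bochner_Integration.integrable_bound[OF G])
    (measurable, use dom in eventually_elim, force intro: order_trans[OF _ abs_ge_self])

lemma partition_pos: "y \<in> S \<Longrightarrow> 0 < partition_fun (h y)"
  by (rule partition_fun_pos[OF integrable_weight])

lemma integrable_parts:
  shows "integrable lborel (\<lambda>z. exp (- h x z) * h' x z v)"
    and "integrable lborel (\<lambda>z. exp (- h x z) *\<^sub>R \<phi>' x z v)"
    and "integrable lborel (\<lambda>z. exp (- h x z) *\<^sub>R h' x z v *\<^sub>R \<phi> x z)"
proof -
  note G' = integrable_mult_left[OF G, of "norm v"]
  note [simp] = S(2)
  show "integrable lborel (\<lambda>z. exp (- h x z) * h' x z v)"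
    by (rule Bochner_Integration.integrable_bound[OF G'])
      (measurable, use dom in eventually_elim,
        use S(2) in \<open>auto simp: abs_mult intro: order_trans[OF _ mult_right_mono[OF abs_ge_self norm_ge_zero]]\<close>)
  show "integrable lborel (\<lambda>z. exp (- h x z) *\<^sub>R \<phi>' x z v)"
    by (rule Bochner_Integration.integrable_bound[OF G'])
      (measurable, use dom in eventually_elim,
        use S(2) in \<open>auto simp: abs_mult intro: order_trans[OF _ mult_right_mono[OF abs_ge_self norm_ge_zero]]\<close>)
  show "integrable lborel (\<lambda>z. exp (- h x z) *\<^sub>R h' x z v *\<^sub>R \<phi> x z)"
    by (rule Bochner_Integration.integrable_bound[OF G'])
      (measurable, use dom in eventually_elim,
        use S(2) in \<open>auto simp: abs_mult mult.assoc intro: order_trans[OF _ mult_right_mono[OF abs_ge_self norm_ge_zero]]\<close>)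
qed

lemma has_derivative_partition_fun:
  "((\<lambda>y. partition_fun (h y)) has_derivative (\<lambda>v. - (\<integral>z. exp (- h x z) * h' x z v \<partial>lborel)))
    (at x within S)"
proof -
  have "((\<lambda>y. \<integral>z. exp (- h y z) \<partial>lborel) has_derivative
      (\<lambda>v. \<integral>z. exp (- h x z) * (- h' x z v) \<partial>lborel)) (at x within S)"
  proof (rule has_derivative_lebesgue_integral_dominated[where
        f' = "\<lambda>y z v. exp (- h y z) * (- h' y z v)", OF S integrable_weight _ G])
    show "(\<lambda>z. exp (- h x z) * (- h' x z v)) \<in> borel_measurable lborel" for v
      using S(2) by measurable
    show "AE z in lborel. \<forall>y\<in>S.
        ((\<lambda>y. exp (- h y z)) has_derivative (\<lambda>v. exp (- h y z) * (- h' y z v))) (at y within S) \<and>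
        (\<forall>v. norm (exp (- h y z) * (- h' y z v)) \<le> G z * norm v)"
      using dom by eventually_elim (force intro!: derivative_eq_intros simp: abs_mult)
  qed
  then show ?thesis by (simp add: partition_fun_def)
qed

lemma has_derivative_ln_partition_fun:
  "((\<lambda>y. ln (partition_fun (h y))) has_derivative (\<lambda>v. - gibbs (h x) (\<lambda>z. h' x z v))) (at x within S)"
proof (rule has_derivative_eq_rhs)
  show "((\<lambda>y. ln (partition_fun (h y))) has_derivative
     (\<lambda>v. - (\<integral>z. exp (- h x z) * h' x z v \<partial>lborel) * inverse (partition_fun (h x)))) (at x within S)"
    using has_derivative_partition_fun partition_pos[OF S(2)] by (auto intro!: derivative_eq_intros simp: divide_inverse)
qed (simp add: gibbs_def fun_eq_iff)

text \<open>This is the quotient rule. Differentiating the numerator gives the first two terms of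
  \<open>gibbs_response\<close>; differentiating the inverse partition function gives the last,
  whose sign is positive because the minus of the exponent meets the minus of the inverse.\<close>

lemma has_derivative_gibbs:
  "((\<lambda>y. gibbs (h y) (\<phi> y)) has_derivative
     (\<lambda>v. gibbs_response (h x) (\<lambda>z. h' x z v) (\<lambda>z. \<phi>' x z v) (\<phi> x))) (at x within S)"
proof -
  \<comment> \<open>The majorant doubles because the product rule leaves two terms, each bounded by
    \<open>G\<close>.\<close>
  have N: "((\<lambda>y. \<integral>z. exp (- h y z) *\<^sub>R \<phi> y z \<partial>lborel) has_derivative
      (\<lambda>v. \<integral>z. exp (- h x z) *\<^sub>R \<phi>' x z v - exp (- h x z) *\<^sub>R h' x z v *\<^sub>R \<phi> x z \<partial>lborel)) (at x within S)"
  proof (rule has_derivative_lebesgue_integral_dominated[where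
        f' = "\<lambda>y z v. exp (- h y z) *\<^sub>R \<phi>' y z v - exp (- h y z) *\<^sub>R h' y z v *\<^sub>R \<phi> y z"
        and G = "\<lambda>z. 2 * G z", OF S integrable_weight_observable])
    show "(\<lambda>z. exp (- h x z) *\<^sub>R \<phi>' x z v - exp (- h x z) *\<^sub>R h' x z v *\<^sub>R \<phi> x z) \<in> borel_measurable lborel" for v
      using S(2) by measurable
    show "AE z in lborel. \<forall>y\<in>S.
        ((\<lambda>y. exp (- h y z) *\<^sub>R \<phi> y z) has_derivative
          (\<lambda>v. exp (- h y z) *\<^sub>R \<phi>' y z v - exp (- h y z) *\<^sub>R h' y z v *\<^sub>R \<phi> y z)) (at y within S) \<and>
        (\<forall>v. norm (exp (- h y z) *\<^sub>R \<phi>' y z v - exp (- h y z) *\<^sub>R h' y z v *\<^sub>R \<phi> y z) \<le> 2 * G z * norm v)"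
      using dom
    proof eventually_elim
      case (elim z)
      show ?case
      proof (intro ballI conjI allI)
        fix y assume y: "y \<in> S"
        note [derivative_intros] = bspec[OF elim y, THEN conjunct1]
          bspec[OF elim y, THEN conjunct2, THEN conjunct1]
        show "((\<lambda>y. exp (- h y z) *\<^sub>R \<phi> y z) has_derivative
          (\<lambda>v. exp (- h y z) *\<^sub>R \<phi>' y z v - exp (- h y z) *\<^sub>R h' y z v *\<^sub>R \<phi> y z)) (at y within S)"
          by (auto intro!: derivative_eq_intros)
        fix v
        have "norm (exp (- h y z) *\<^sub>R \<phi>' y z v) \<le> G z * norm v"
          "norm (exp (- h y z) *\<^sub>R h' y z v *\<^sub>R \<phi> y z) \<le> G z * norm v"
          using elim y by (auto simp: abs_mult mult.assoc)
        then show "norm (exp (- h y z) *\<^sub>R \<phi>' y z v - exp (- h y z) *\<^sub>R h' y z v *\<^sub>R \<phi> y z) \<le> 2 * G z * norm v"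
          using norm_triangle_ineq4[of "exp (- h y z) *\<^sub>R \<phi>' y z v" "exp (- h y z) *\<^sub>R h' y z v *\<^sub>R \<phi> y z"]
          by simp
      qed
    qed
  qed (use G in auto)
  have Z0: "partition_fun (h x) \<noteq> 0" using partition_pos[OF S(2)] by simp
  show ?thesis
    unfolding gibbs_response_def gibbs_def
    by (rule has_derivative_eq_rhs,
        rule has_derivative_scaleR[OF Deriv.has_derivative_inverse[OF Z0 has_derivative_partition_fun] N])
      (simp only: fun_eq_iff Bochner_Integration.integral_diff[OF integrable_parts(2,3)],
        simp add: Z0 scaleR_diff_right ac_simps)
qed

end

text \<open>A directional derivative is a pointwise limit of difference quotients along the
  countable sequence of steps \<open>r n\<close>, and such limits stay measurable. The index shift
  by \<open>N\<close> keeps the evaluation points in \<open>U\<close>, where measurability is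
  available.\<close>

lemma borel_measurable_frechet_derivative:
  fixes f :: "'a::real_normed_vector \<Rightarrow> 'c \<Rightarrow> 'b::euclidean_space"
  assumes "open U" "x \<in> U"
    and f: "\<And>y. y \<in> U \<Longrightarrow> f y \<in> borel_measurable M"
    and diff: "\<And>z. z \<in> space M \<Longrightarrow> (\<lambda>y. f y z) differentiable (at x)"
  shows "(\<lambda>z. frechet_derivative (\<lambda>y. f y z) (at x) v) \<in> borel_measurable M"
proof -
  define r where "r n = inverse (real (Suc n))" for n
  have r: "r \<longlonglongrightarrow> 0" unfolding r_def by (rule LIMSEQ_inverse_real_of_nat)
  have "(\<lambda>n. x + r n *\<^sub>R v) \<longlonglongrightarrow> x + 0 *\<^sub>R v"
    by (intro tendsto_intros r)
  then have "eventually (\<lambda>n. x + r n *\<^sub>R v \<in> U) sequentially"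
    using topological_tendstoD[of _ "x + 0 *\<^sub>R v" sequentially U] assms(1,2) by simp
  then obtain N where N: "\<And>n. n \<ge> N \<Longrightarrow> x + r n *\<^sub>R v \<in> U"
    by (auto simp: eventually_sequentially)
  show ?thesis
  proof (rule borel_measurable_LIMSEQ_metric)
    show "(\<lambda>z. (f (x + r (n + N) *\<^sub>R v) z - f x z) /\<^sub>R r (n + N)) \<in> borel_measurable M" for n
      using f[OF N[of "n + N"]] f[OF \<open>x \<in> U\<close>] by simp
    fix z assume z: "z \<in> space M"
    have "((\<lambda>y. f y z) has_derivative frechet_derivative (\<lambda>y. f y z) (at x)) (at x)"
      using diff[OF z] frechet_derivative_works by blast
    then have "((\<lambda>s. f (x + s *\<^sub>R v) z) has_derivative
        (\<lambda>s. frechet_derivative (\<lambda>y. f y z) (at x) (s *\<^sub>R v))) (at 0)"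
      by (intro has_derivative_compose[of "\<lambda>s. x + s *\<^sub>R v" "\<lambda>s. s *\<^sub>R v" 0 UNIV "\<lambda>y. f y z", simplified])
        (auto intro!: derivative_eq_intros)
    moreover have "frechet_derivative (\<lambda>y. f y z) (at x) (s *\<^sub>R v) = s *\<^sub>R frechet_derivative (\<lambda>y. f y z) (at x) v" for s
      using linear_frechet_derivative[OF diff[OF z]] by (simp add: linear_scale)
    ultimately have "((\<lambda>s. f (x + s *\<^sub>R v) z) has_vector_derivative frechet_derivative (\<lambda>y. f y z) (at x) v) (at 0)"
      by (simp add: has_vector_derivative_def)
    then have "((\<lambda>s. (f (x + s *\<^sub>R v) z - f x z - s *\<^sub>R frechet_derivative (\<lambda>y. f y z) (at x) v) /\<^sub>R norm s)
        \<longlongrightarrow> 0) (at 0)"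
      by (simp add: has_vector_derivative_def has_derivative_at_within)
    moreover have "filterlim (\<lambda>n. r (n + N)) (at 0) sequentially"
      using LIMSEQ_ignore_initial_segment[OF r, of N] by (auto simp: filterlim_at r_def)
    ultimately have "(\<lambda>n. (f (x + r (n + N) *\<^sub>R v) z - f x z
        - r (n + N) *\<^sub>R frechet_derivative (\<lambda>y. f y z) (at x) v) /\<^sub>R norm (r (n + N))) \<longlonglongrightarrow> 0"
      by (rule filterlim_compose)
    moreover have "(u - r n *\<^sub>R w) /\<^sub>R norm (r n) = u /\<^sub>R r n - w" for u w :: 'b and n
      by (simp add: scaleR_diff_right r_def abs_inverse)
    ultimately show "(\<lambda>n. (f (x + r (n + N) *\<^sub>R v) z - f x z) /\<^sub>R r (n + N))
        \<longlonglongrightarrow> frechet_derivative (\<lambda>y. f y z) (at x) v"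
      by (simp add: LIM_zero_iff)
  qed
qed

section \<open>Gradients and Hessians\<close>

text \<open>The norm of a matrix is here the Frobenius norm, the Euclidean norm of its row norms, so
  Cauchy-Schwarz on each row suffices.\<close>

lemma matrix_vector_mult_norm_le: "norm (A *v v) \<le> norm A * norm v" for A :: "real^'n^'m"
proof -
  have "norm (A *v v) = L2_set (\<lambda>i. norm ((A *v v) $ i)) UNIV" by (simp only: norm_vec_def)
  also have "\<dots> \<le> L2_set (\<lambda>i. norm (A $ i) * norm v) UNIV"
    by (rule L2_set_mono) (use Cauchy_Schwarz_ineq2 in \<open>auto simp: matrix_vector_mul_component\<close>)
  also have "\<dots> = norm A * norm v"
    by (simp add: norm_vec_def[of A] L2_set_left_distrib)
  finally show ?thesis .
qed

lemma differentiable_transform_open: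
  assumes "f differentiable (at x)" "open U" "x \<in> U" "\<And>y. y \<in> U \<Longrightarrow> g y = f y"
  shows "g differentiable (at x)"
  using assms has_derivative_transform_within_open[of f _ x UNIV U g]
  unfolding differentiable_def by metis

lemma has_derivative_grad:
  assumes "f differentiable (at x)"
  shows "(f has_derivative (\<lambda>v. grad f x \<bullet> v)) (at x)"
proof -
  let ?D = "frechet_derivative f (at x)"
  have "?D v = grad f x \<bullet> v" for v
  proof -
    have lin: "linear ?D" using assms by (rule linear_frechet_derivative)
    have "?D v = ?D (\<Sum>i\<in>UNIV. (v $ i) *\<^sub>R axis i 1)"
      using basis_expansion[of v] by (simp add: scalar_mult_eq_scaleR)
    also have "\<dots> = (\<Sum>i\<in>UNIV. (v $ i) *\<^sub>R ?D (axis i 1))"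
      using lin by (simp add: linear_sum linear_scale)
    finally show ?thesis by (simp add: grad_def inner_vec_def mult.commute)
  qed
  then have "?D = (\<lambda>v. grad f x \<bullet> v)" ..
  then show ?thesis
    using assms frechet_derivative_works by metis
qed

lemma grad_eqI:
  assumes "(f has_derivative (\<lambda>v. w \<bullet> v)) (at x)"
  shows "grad f x = w"
  using frechet_derivative_at[OF assms, symmetric]
  by (simp add: grad_def inner_axis vec_eq_iff)

lemma has_derivative_hessian:
  "grad f differentiable (at x) \<Longrightarrow> (grad f has_derivative (\<lambda>v. hessian f x *v v)) (at x)"
  by (simp add: hessian_def jacobian_works)

lemma hessian_eqI:
  assumes "(grad f has_derivative (\<lambda>v. A *v v)) (at x)"
  shows "hessian f x = A"
  using frechet_derivative_at[OF assms, symmetric]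
  by (simp add: hessian_def jacobian_def)

text \<open>This is the regularity that the Hessian of the Hamiltonian calls for. Unlike
  \<open>smooth_on\<close>, which exhibits a whole tower of derivatives, it passes through negation
  and logarithm by explicit gradient formulas.\<close>

definition twice_differentiable_on :: "(real^'n \<Rightarrow> real) \<Rightarrow> (real^'n) set \<Rightarrow> bool"
    (infix "twice'_differentiable'_on" 50) where
  "f twice_differentiable_on U \<longleftrightarrow> (\<forall>x\<in>U. f differentiable (at x) \<and> grad f differentiable (at x))"

text \<open>In \<open>smooth_on\<close> a new direction is put at the front of the list. Hence
  \<open>D [axis i 1]\<close> is the i-th component of the gradient, and
  \<open>D [v, axis i 1]\<close> is the derivative of that component along \<open>v\<close>.\<close>

lemma smooth_on_imp_twice_differentiable_on:
  assumes "smooth_on U f" "open U"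
  shows "f twice_differentiable_on U"
proof -
  obtain D where D0: "\<And>x. x \<in> U \<Longrightarrow> D [] x = f x"
    and D: "\<And>vs x. x \<in> U \<Longrightarrow> (D vs has_derivative (\<lambda>v. D (v # vs) x)) (at x)"
    using assms unfolding smooth_on_def by (metis at_within_open)
  have f: "(f has_derivative (\<lambda>v. D [v] x)) (at x)" if "x \<in> U" for x
    using D[OF that, of "[]"] D0 that assms(2)
    by (auto intro: has_derivative_transform_within_open)
  have "((\<lambda>y. \<chi> i. D [axis i 1] y) has_derivative (\<lambda>v. \<chi> i. D [v, axis i 1] x)) (at x)" if "x \<in> U" for x
    using D[OF that] by (auto simp: has_derivative_componentwise_within[of "\<lambda>y. \<chi> i. D [axis i 1] y"]
        Basis_vec_def inner_axis intro!: derivative_eq_intros)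
  moreover have "(\<chi> i. D [axis i 1] y) = grad f y" if "y \<in> U" for y
    using frechet_derivative_at[OF f[OF that], symmetric] by (simp add: grad_def)
  ultimately have "(grad f has_derivative (\<lambda>v. \<chi> i. D [v, axis i 1] x)) (at x)" if "x \<in> U" for x
    using that assms(2) by (auto intro: has_derivative_transform_within_open)
  then show ?thesis
    using f unfolding twice_differentiable_on_def differentiable_def by blast
qed

lemma twice_differentiable_on_minus:
  assumes "f twice_differentiable_on U" "open U"
  shows "(\<lambda>x. - f x) twice_differentiable_on U"
  unfolding twice_differentiable_on_def
proof (intro ballI conjI)
  fix x assume x: "x \<in> U"
  have f: "f differentiable (at y)" "grad f differentiable (at y)" if "y \<in> U" for y
    using assms(1) that by (auto simp: twice_differentiable_on_def)
  show "(\<lambda>x. - f x) differentiable (at x)" using f(1)[OF x] by simp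
  have "grad (\<lambda>x. - f x) y = - grad f y" if "y \<in> U" for y
    using has_derivative_grad[OF f(1)[OF that]] by (intro grad_eqI) (auto intro!: derivative_eq_intros)
  moreover have "(\<lambda>y. - grad f y) differentiable (at x)" using f(2)[OF x] by simp
  ultimately show "grad (\<lambda>x. - f x) differentiable (at x)"
    using x assms(2) by (auto intro: differentiable_transform_open)
qed

lemma twice_differentiable_on_ln:
  assumes "f twice_differentiable_on U" "open U" and pos: "\<And>x. x \<in> U \<Longrightarrow> f x > 0"
  shows "(\<lambda>x. ln (f x)) twice_differentiable_on U"
  unfolding twice_differentiable_on_def
proof (intro ballI conjI)
  fix x assume x: "x \<in> U"
  have f: "f differentiable (at y)" "grad f differentiable (at y)" if "y \<in> U" for y
    using assms(1) that by (auto simp: twice_differentiable_on_def)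
  have ln: "((\<lambda>x. ln (f x)) has_derivative (\<lambda>v. (grad f y /\<^sub>R f y) \<bullet> v)) (at y)" if "y \<in> U" for y
    using has_derivative_grad[OF f(1)[OF that]] pos[OF that]
    by (auto intro!: derivative_eq_intros simp: divide_inverse)
  show "(\<lambda>x. ln (f x)) differentiable (at x)"
    using ln[OF x] unfolding differentiable_def by blast
  have "grad (\<lambda>x. ln (f x)) y = grad f y /\<^sub>R f y" if "y \<in> U" for y
    using ln[OF that] by (rule grad_eqI)
  moreover have "(\<lambda>y. grad f y /\<^sub>R f y) differentiable (at x)"
    using f[OF x] pos[OF x] by (intro differentiable_scaleR differentiable_inverse) auto
  ultimately show "grad (\<lambda>x. ln (f x)) differentiable (at x)"
    using x assms(2) by (auto intro: differentiable_transform_open)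
qed

section \<open>Measurability of gradients and Hessians in the latent code\<close>

lemma borel_measurable_vec:
  fixes f :: "'c \<Rightarrow> 'b::euclidean_space ^ 'n"
  assumes "\<And>i. (\<lambda>z. f z $ i) \<in> borel_measurable M"
  shows "f \<in> borel_measurable M"
  using assms by (intro borel_measurable_euclidean_space[THEN iffD2])
    (auto simp: Basis_vec_def inner_axis intro!: borel_measurable_inner)

lemma borel_measurable_grad:
  fixes f :: "real^'n \<Rightarrow> 'c \<Rightarrow> real"
  assumes "open U" "x \<in> U" "\<And>y. y \<in> U \<Longrightarrow> f y \<in> borel_measurable M"
    and "\<And>z. z \<in> space M \<Longrightarrow> (\<lambda>y. f y z) twice_differentiable_on U"
  shows "(\<lambda>z. grad (\<lambda>y. f y z) x) \<in> borel_measurable M"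
  by (rule borel_measurable_vec, simp add: grad_def, rule borel_measurable_frechet_derivative[OF assms(1-3)])
    (use assms in \<open>auto simp: twice_differentiable_on_def\<close>)

text \<open>The difference quotient argument is applied a second time, to the gradient, whose
  measurability must therefore be at hand at every point of \<open>U\<close>.\<close>

lemma borel_measurable_hessian:
  fixes f :: "real^'n \<Rightarrow> 'c \<Rightarrow> real"
  assumes "open U" "x \<in> U" "\<And>y. y \<in> U \<Longrightarrow> f y \<in> borel_measurable M"
    and "\<And>z. z \<in> space M \<Longrightarrow> (\<lambda>y. f y z) twice_differentiable_on U"
  shows "(\<lambda>z. hessian (\<lambda>y. f y z) x) \<in> borel_measurable M"
proof -
  have "(\<lambda>z. frechet_derivative (\<lambda>y. grad (\<lambda>y. f y z) y) (at x) v) \<in> borel_measurable M" for v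
    by (rule borel_measurable_frechet_derivative[OF assms(1,2) borel_measurable_grad[OF assms(1)]])
      (use assms in \<open>auto simp: twice_differentiable_on_def\<close>)
  then have "(\<lambda>z. frechet_derivative (\<lambda>y. grad (\<lambda>y. f y z) y) (at x) v $ i) \<in> borel_measurable M" for v i
    by (rule measurable_compose) (intro borel_measurable_continuous_onI continuous_intros)
  then show ?thesis
    by (intro borel_measurable_vec) (simp add: hessian_def jacobian_def matrix_def)
qed

section \<open>Hamiltonians affine in the two multipliers\<close>

text \<open>The coefficients \<open>a\<close>, \<open>b\<close>, \<open>e\<close> stand for the
  negative logarithms of the prior, the decoder and the classifier. The affine form makes the
  derivatives in both multipliers exist for each fixed \<open>z\<close>, at all values of the
  multipliers and irrespective of integrability, and it reduces measurability and differentiability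
  to three functions of the parameter and the code.\<close>

locale affine_hamiltonian =
  fixes U :: "(real^'n) set"
    and H :: "'x \<Rightarrow> real^'n \<Rightarrow> real \<Rightarrow> real \<Rightarrow> 'z::euclidean_space \<Rightarrow> real"
    and x :: 'x and a b e :: "real^'n \<Rightarrow> 'z \<Rightarrow> real"
  assumes open_U: "open U"
    and H_eq: "\<And>\<theta> l g z. H x \<theta> l g z = a \<theta> z + l * b \<theta> z + g * e \<theta> z"
    and measurable_coeffs: "\<And>\<theta>. \<theta> \<in> U \<Longrightarrow> a \<theta> \<in> borel_measurable lborel"
      "\<And>\<theta>. \<theta> \<in> U \<Longrightarrow> b \<theta> \<in> borel_measurable lborel"
      "\<And>\<theta>. \<theta> \<in> U \<Longrightarrow> e \<theta> \<in> borel_measurable lborel"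
    and twice_differentiable_coeffs: "\<And>z. (\<lambda>\<theta>. a \<theta> z) twice_differentiable_on U"
      "\<And>z. (\<lambda>\<theta>. b \<theta> z) twice_differentiable_on U"
      "\<And>z. (\<lambda>\<theta>. e \<theta> z) twice_differentiable_on U"
begin

lemma has_derivative_coeffs:
  assumes "\<theta> \<in> U"
  shows "((\<lambda>\<theta>. a \<theta> z) has_derivative (\<lambda>v. grad (\<lambda>\<theta>. a \<theta> z) \<theta> \<bullet> v)) (at \<theta>)"
    and "((\<lambda>\<theta>. b \<theta> z) has_derivative (\<lambda>v. grad (\<lambda>\<theta>. b \<theta> z) \<theta> \<bullet> v)) (at \<theta>)"
    and "((\<lambda>\<theta>. e \<theta> z) has_derivative (\<lambda>v. grad (\<lambda>\<theta>. e \<theta> z) \<theta> \<bullet> v)) (at \<theta>)"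
    and "(grad (\<lambda>\<theta>. a \<theta> z) has_derivative (\<lambda>v. hessian (\<lambda>\<theta>. a \<theta> z) \<theta> *v v)) (at \<theta>)"
    and "(grad (\<lambda>\<theta>. b \<theta> z) has_derivative (\<lambda>v. hessian (\<lambda>\<theta>. b \<theta> z) \<theta> *v v)) (at \<theta>)"
    and "(grad (\<lambda>\<theta>. e \<theta> z) has_derivative (\<lambda>v. hessian (\<lambda>\<theta>. e \<theta> z) \<theta> *v v)) (at \<theta>)"
  using twice_differentiable_coeffs[of z] assms
  by (auto simp: twice_differentiable_on_def intro!: has_derivative_grad has_derivative_hessian)

lemma grad_H_eq:
  assumes "\<theta> \<in> U"
  shows "grad_H H x \<theta> l g z =
    grad (\<lambda>\<theta>. a \<theta> z) \<theta> + l *\<^sub>R grad (\<lambda>\<theta>. b \<theta> z) \<theta> + g *\<^sub>R grad (\<lambda>\<theta>. e \<theta> z) \<theta>"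
  unfolding grad_H_def H_eq
  by (rule grad_eqI) (auto intro!: derivative_eq_intros has_derivative_coeffs[OF assms] simp: inner_add_left)

lemma hess_H_eq:
  assumes "\<theta> \<in> U"
  shows "hess_H H x \<theta> l g z =
    hessian (\<lambda>\<theta>. a \<theta> z) \<theta> + l *\<^sub>R hessian (\<lambda>\<theta>. b \<theta> z) \<theta> + g *\<^sub>R hessian (\<lambda>\<theta>. e \<theta> z) \<theta>"
  unfolding hess_H_def
proof (rule hessian_eqI, rule has_derivative_transform_within_open[OF _ open_U assms])
  show "((\<lambda>\<theta>. grad (\<lambda>\<theta>. a \<theta> z) \<theta> + l *\<^sub>R grad (\<lambda>\<theta>. b \<theta> z) \<theta> + g *\<^sub>R grad (\<lambda>\<theta>. e \<theta> z) \<theta>) has_derivative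
      (\<lambda>v. (hessian (\<lambda>\<theta>. a \<theta> z) \<theta> + l *\<^sub>R hessian (\<lambda>\<theta>. b \<theta> z) \<theta> + g *\<^sub>R hessian (\<lambda>\<theta>. e \<theta> z) \<theta>) *v v)) (at \<theta>)"
    by (auto intro!: derivative_eq_intros has_derivative_coeffs[OF assms]
        simp: matrix_vector_mult_add_rdistrib scaleR_matrix_vector_assoc)
qed (simp add: grad_H_eq[unfolded grad_H_def])

lemma dlam_H: "dlam H x \<theta> l g z = b \<theta> z" and dgam_H: "dgam H x \<theta> l g z = e \<theta> z"
  unfolding dlam_def dgam_def H_eq
  by (rule vector_derivative_at, (auto intro!: derivative_eq_intros)[1])+

lemma dlam_grad_H: "\<theta> \<in> U \<Longrightarrow> dlam (grad_H H) x \<theta> l g z = grad (\<lambda>\<theta>. b \<theta> z) \<theta>"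
  and dgam_grad_H: "\<theta> \<in> U \<Longrightarrow> dgam (grad_H H) x \<theta> l g z = grad (\<lambda>\<theta>. e \<theta> z) \<theta>"
  by (simp_all add: dlam_def dgam_def grad_H_eq)

lemma borel_measurable_H [measurable]:
  assumes "\<theta> \<in> U"
  shows "H x \<theta> l g \<in> borel_measurable lborel"
    and "grad_H H x \<theta> l g \<in> borel_measurable lborel"
    and "hess_H H x \<theta> l g \<in> borel_measurable lborel"
    and "dlam H x \<theta> l g \<in> borel_measurable lborel"
    and "dgam H x \<theta> l g \<in> borel_measurable lborel"
    and "dlam (grad_H H) x \<theta> l g \<in> borel_measurable lborel"
    and "dgam (grad_H H) x \<theta> l g \<in> borel_measurable lborel"
proof -
  note [measurable] = measurable_coeffs
    borel_measurable_grad[OF open_U assms measurable_coeffs(1) twice_differentiable_coeffs(1)]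
    borel_measurable_grad[OF open_U assms measurable_coeffs(2) twice_differentiable_coeffs(2)]
    borel_measurable_grad[OF open_U assms measurable_coeffs(3) twice_differentiable_coeffs(3)]
    borel_measurable_hessian[OF open_U assms measurable_coeffs(1) twice_differentiable_coeffs(1)]
    borel_measurable_hessian[OF open_U assms measurable_coeffs(2) twice_differentiable_coeffs(2)]
    borel_measurable_hessian[OF open_U assms measurable_coeffs(3) twice_differentiable_coeffs(3)]
  note [simp] = assms
  show "H x \<theta> l g \<in> borel_measurable lborel"
    unfolding H_eq[abs_def] by measurable
  show "grad_H H x \<theta> l g \<in> borel_measurable lborel"
    unfolding grad_H_eq[OF assms, abs_def] by measurable
  show "hess_H H x \<theta> l g \<in> borel_measurable lborel"
    unfolding hess_H_eq[OF assms, abs_def] by measurable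
  show "dlam H x \<theta> l g \<in> borel_measurable lborel" "dgam H x \<theta> l g \<in> borel_measurable lborel"
    unfolding dlam_H[abs_def] dgam_H[abs_def] by measurable
  show "dlam (grad_H H) x \<theta> l g \<in> borel_measurable lborel"
    unfolding dlam_grad_H[OF assms, abs_def] by measurable
  show "dgam (grad_H H) x \<theta> l g \<in> borel_measurable lborel"
    unfolding dgam_grad_H[OF assms, abs_def] by measurable
qed

lemma has_derivative_H:
  assumes "\<theta> \<in> U"
  shows "((\<lambda>\<theta>. H x \<theta> l g z) has_derivative (\<lambda>v. grad_H H x \<theta> l g z \<bullet> v)) (at \<theta>)"
  unfolding H_eq grad_H_eq[OF assms]
  by (auto intro!: derivative_eq_intros has_derivative_coeffs[OF assms] simp: inner_add_left)

lemma has_derivative_grad_H: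
  assumes "\<theta> \<in> U"
  shows "((\<lambda>\<theta>. grad_H H x \<theta> l g z) has_derivative (\<lambda>v. hess_H H x \<theta> l g z *v v)) (at \<theta>)"
proof (rule has_derivative_transform_within_open[OF _ open_U assms])
  show "((\<lambda>\<theta>. grad (\<lambda>\<theta>. a \<theta> z) \<theta> + l *\<^sub>R grad (\<lambda>\<theta>. b \<theta> z) \<theta> + g *\<^sub>R grad (\<lambda>\<theta>. e \<theta> z) \<theta>) has_derivative
      (\<lambda>v. hess_H H x \<theta> l g z *v v)) (at \<theta>)"
    by (auto intro!: derivative_eq_intros has_derivative_coeffs[OF assms]
        simp: hess_H_eq[OF assms] matrix_vector_mult_add_rdistrib scaleR_matrix_vector_assoc)
qed (simp add: grad_H_eq)

text \<open>For fixed \<open>z\<close> only the chain rule for three coefficients along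
  \<open>th\<close> and the product rule with \<open>lam\<close> and \<open>gam\<close> are
  involved. The path has to stay in \<open>U\<close> because the explicit formula for
  \<open>grad_H\<close> is available only there.\<close>

lemma has_derivative_H_path:
  assumes th: "(th has_vector_derivative thd) (at s within T)"
    and lam: "(lam has_vector_derivative ld) (at s within T)"
    and gam: "(gam has_vector_derivative gd) (at s within T)"
    and s: "s \<in> T" and sub: "th ` T \<subseteq> U"
  shows "((\<lambda>s. H x (th s) (lam s) (gam s) z) has_derivative
      (\<lambda>v. v * (grad_H H x (th s) (lam s) (gam s) z \<bullet> thd
        + ld * dlam H x (th s) (lam s) (gam s) z + gd * dgam H x (th s) (lam s) (gam s) z))) (at s within T)"
    and "((\<lambda>s. grad_H H x (th s) (lam s) (gam s) z) has_derivative
      (\<lambda>v. v *\<^sub>R (hess_H H x (th s) (lam s) (gam s) z *v thd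
        + ld *\<^sub>R dlam (grad_H H) x (th s) (lam s) (gam s) z
        + gd *\<^sub>R dgam (grad_H H) x (th s) (lam s) (gam s) z))) (at s within T)"
proof -
  have U: "th s \<in> U" using s sub by auto
  note th' = th[unfolded has_vector_derivative_def]
  have comp: "((\<lambda>s. f (th s)) has_derivative (\<lambda>v. f' (v *\<^sub>R thd))) (at s within T)"
    if "(f has_derivative f') (at (th s))" for f :: "real^'n \<Rightarrow> 'w::real_normed_vector" and f'
    using has_derivative_compose[OF th' that] by simp
  note D = has_derivative_coeffs[OF U, THEN comp] lam[unfolded has_vector_derivative_def]
    gam[unfolded has_vector_derivative_def]
  show "((\<lambda>s. H x (th s) (lam s) (gam s) z) has_derivative
      (\<lambda>v. v * (grad_H H x (th s) (lam s) (gam s) z \<bullet> thd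
        + ld * dlam H x (th s) (lam s) (gam s) z + gd * dgam H x (th s) (lam s) (gam s) z))) (at s within T)"
    unfolding H_eq grad_H_eq[OF U] dlam_H dgam_H
    by (auto intro!: derivative_eq_intros D simp: inner_add_left algebra_simps)
  show "((\<lambda>s. grad_H H x (th s) (lam s) (gam s) z) has_derivative
      (\<lambda>v. v *\<^sub>R (hess_H H x (th s) (lam s) (gam s) z *v thd
        + ld *\<^sub>R dlam (grad_H H) x (th s) (lam s) (gam s) z
        + gd *\<^sub>R dgam (grad_H H) x (th s) (lam s) (gam s) z))) (at s within T)"
  proof (rule has_derivative_transform[OF s])
    show "((\<lambda>s. grad (\<lambda>\<theta>. a \<theta> z) (th s) + lam s *\<^sub>R grad (\<lambda>\<theta>. b \<theta> z) (th s)
         + gam s *\<^sub>R grad (\<lambda>\<theta>. e \<theta> z) (th s)) has_derivative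
      (\<lambda>v. v *\<^sub>R (hess_H H x (th s) (lam s) (gam s) z *v thd
        + ld *\<^sub>R dlam (grad_H H) x (th s) (lam s) (gam s) z
        + gd *\<^sub>R dgam (grad_H H) x (th s) (lam s) (gam s) z))) (at s within T)"
      unfolding hess_H_eq[OF U] dlam_grad_H[OF U] dgam_grad_H[OF U]
      by (auto intro!: derivative_eq_intros D simp: matrix_vector_mult_add_rdistrib
          scaleR_matrix_vector_assoc[symmetric] matrix_vector_mult_scaleR scaleR_add_right ac_simps)
  qed (use sub in \<open>auto simp: grad_H_eq\<close>)
qed

end

section \<open>Linearity of Gibbs averages, and the Hessian of the energy of one datum\<close>

lemma gibbs_add:
  assumes "integrable lborel (\<lambda>z. exp (- h z) *\<^sub>R \<phi> z)" "integrable lborel (\<lambda>z. exp (- h z) *\<^sub>R \<psi> z)"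
  shows "gibbs h (\<lambda>z. \<phi> z + \<psi> z) = gibbs h \<phi> + gibbs h \<psi>"
  using assms by (simp add: gibbs_def scaleR_add_right)

text \<open>No integrability is involved: a nonzero factor preserves non-integrability, where the
  integral is 0 by default, and the factor 0 gives 0 on both sides.\<close>

lemma gibbs_scaleR: "gibbs h (\<lambda>z. r *\<^sub>R \<phi> z) = r *\<^sub>R gibbs h \<phi>"
proof -
  have "gibbs h (\<lambda>z. r *\<^sub>R \<phi> z) = (\<integral>z. r *\<^sub>R (exp (- h z) *\<^sub>R \<phi> z) \<partial>lborel) /\<^sub>R partition_fun h"
    unfolding gibbs_def by (subst scaleR_left_commute) simp
  then show ?thesis unfolding integral_scaleR_right by (simp add: gibbs_def)
qed

lemma gibbs_bounded_linear:
  assumes "bounded_linear T" "integrable lborel (\<lambda>z. exp (- h z) *\<^sub>R \<phi> z)"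
  shows "gibbs h (\<lambda>z. T (\<phi> z)) = T (gibbs h \<phi>)"
  using integral_bounded_linear[OF assms] linear_scale[OF bounded_linear.linear[OF assms(1)]]
  by (simp add: gibbs_def)

lemma bounded_linear_matrix_vector_mult_left: "bounded_linear (\<lambda>A. A *v v)"
  for v :: "real^'n"
  by (rule linear_conv_bounded_linear[THEN iffD1], rule linearI)
    (simp_all add: matrix_vector_mult_add_rdistrib scaleR_matrix_vector_assoc)

lemma outer_mult_vec: "outer v w *v u = (w \<bullet> u) *\<^sub>R v"
  by (simp add: vec_eq_iff outer_def matrix_vector_mult_def inner_vec_def sum_distrib_left mult_ac)

text \<open>This is what lets the weighted square of the gradient norm dominate the weighted outer
  product.\<close>

lemma norm_outer: "norm (outer v w) = norm v * norm w"
proof -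
  have "norm (outer v w $ i) = norm (v $ i) * norm w" for i
  proof -
    have "outer v w $ i = (v $ i) *\<^sub>R w" by (simp add: outer_def vec_eq_iff)
    then show ?thesis by simp
  qed
  then show ?thesis
    by (simp add: norm_vec_def[of "outer v w"] norm_vec_def[of v] L2_set_left_distrib)
qed

text \<open>The innermost conjunction of \<open>locally_dominated\<close> at a single bound. Naming
  it allows the quantified almost-everywhere statement to be instantiated first and unfolded
  afterwards.\<close>

definition integrands_le ::
    "('x \<Rightarrow> real^'n \<Rightarrow> real \<Rightarrow> real \<Rightarrow> 'z \<Rightarrow> real) \<Rightarrow> 'x \<Rightarrow> real^'n \<Rightarrow> real \<Rightarrow> real \<Rightarrow> 'z \<Rightarrow> real \<Rightarrow> bool" where
  "integrands_le H x \<theta> l g z C \<longleftrightarrow>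
     (let w = exp (- H x \<theta> l g z); a = norm (grad_H H x \<theta> l g z)
      in w \<le> C \<and> w * a \<le> C \<and> w * a\<^sup>2 \<le> C \<and>
         w * norm (hess_H H x \<theta> l g z) \<le> C \<and>
         w * \<bar>dlam H x \<theta> l g z\<bar> \<le> C \<and>
         w * \<bar>dgam H x \<theta> l g z\<bar> \<le> C \<and>
         w * (\<bar>dlam H x \<theta> l g z\<bar> * a) \<le> C \<and>
         w * (\<bar>dgam H x \<theta> l g z\<bar> * a) \<le> C \<and>
         w * norm (dlam (grad_H H) x \<theta> l g z) \<le> C \<and>
         w * norm (dgam (grad_H H) x \<theta> l g z) \<le> C)"

lemma locally_dominatedE:
  assumes "locally_dominated H th lam gam x t"
  obtains \<epsilon> G where "\<epsilon> > 0" "integrable lborel G"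
    "AE z in lborel. \<forall>\<theta>\<in>ball (th t) \<epsilon>. \<forall>s\<in>ball t \<epsilon> \<inter> {0..1}.
       integrands_le H x \<theta> (lam s) (gam s) z (G z)"
  using assms unfolding locally_dominated_def integrands_le_def Let_def by blast

text \<open>This is the mean Hessian minus the Gibbs covariance of the gradient, that is, the
  Hessian of \<open>- ln (partition_fun (H x \<theta> l g))\<close> in the parameter.\<close>

definition hess_datum_energy ::
    "('x \<Rightarrow> real^'n \<Rightarrow> real \<Rightarrow> real \<Rightarrow> 'z::euclidean_space \<Rightarrow> real) \<Rightarrow> 'x \<Rightarrow> real^'n \<Rightarrow> real \<Rightarrow> real \<Rightarrow> real^'n^'n" where
  "hess_datum_energy H x \<theta> l g =
     gibbs (H x \<theta> l g) (hess_H H x \<theta> l g)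
     + outer (gibbs (H x \<theta> l g) (grad_H H x \<theta> l g)) (gibbs (H x \<theta> l g) (grad_H H x \<theta> l g))
     - gibbs (H x \<theta> l g) (\<lambda>z. outer (grad_H H x \<theta> l g z) (grad_H H x \<theta> l g z))"

section \<open>Gibbs averages of the gradient: derivatives in the parameter and along the
  path\<close>

context affine_hamiltonian
begin

text \<open>Taken at the centre \<open>th t\<close>, \<open>t\<close> of the domination, its bounds
  make each integrand integrable, which is what splitting the Gibbs average of a sum
  requires.\<close>

lemma integrable_gibbs_integrands:
  fixes th lam gam t
  defines "\<theta> \<equiv> th t" and "l \<equiv> lam t" and "g \<equiv> gam t"
  assumes U: "th t \<in> U" and t: "t \<in> {0..1}" and dom: "locally_dominated H th lam gam x t"
  shows "integrable lborel (\<lambda>z. exp (- H x \<theta> l g z) *\<^sub>R grad_H H x \<theta> l g z)"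
    and "integrable lborel (\<lambda>z. exp (- H x \<theta> l g z) *\<^sub>R hess_H H x \<theta> l g z)"
    and "integrable lborel (\<lambda>z. exp (- H x \<theta> l g z) *\<^sub>R outer (grad_H H x \<theta> l g z) (grad_H H x \<theta> l g z))"
    and "integrable lborel (\<lambda>z. exp (- H x \<theta> l g z) *\<^sub>R dlam H x \<theta> l g z)"
    and "integrable lborel (\<lambda>z. exp (- H x \<theta> l g z) *\<^sub>R dgam H x \<theta> l g z)"
    and "integrable lborel (\<lambda>z. exp (- H x \<theta> l g z) *\<^sub>R dlam H x \<theta> l g z *\<^sub>R grad_H H x \<theta> l g z)"
    and "integrable lborel (\<lambda>z. exp (- H x \<theta> l g z) *\<^sub>R dgam H x \<theta> l g z *\<^sub>R grad_H H x \<theta> l g z)"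
    and "integrable lborel (\<lambda>z. exp (- H x \<theta> l g z) *\<^sub>R dlam (grad_H H) x \<theta> l g z)"
    and "integrable lborel (\<lambda>z. exp (- H x \<theta> l g z) *\<^sub>R dgam (grad_H H) x \<theta> l g z)"
proof -
  obtain \<epsilon> G where \<epsilon>: "\<epsilon> > 0" and G: "integrable lborel G"
    and ae: "AE z in lborel. \<forall>\<theta>\<in>ball (th t) \<epsilon>. \<forall>s\<in>ball t \<epsilon> \<inter> {0..1}.
           integrands_le H x \<theta> (lam s) (gam s) z (G z)"
    using dom by (rule locally_dominatedE)
  have ae': "AE z in lborel. exp (- H x \<theta> l g z) * norm (grad_H H x \<theta> l g z) \<le> G z \<and>
      exp (- H x \<theta> l g z) * (norm (grad_H H x \<theta> l g z))\<^sup>2 \<le> G z \<and>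
      exp (- H x \<theta> l g z) * norm (hess_H H x \<theta> l g z) \<le> G z \<and>
      exp (- H x \<theta> l g z) * \<bar>dlam H x \<theta> l g z\<bar> \<le> G z \<and>
      exp (- H x \<theta> l g z) * \<bar>dgam H x \<theta> l g z\<bar> \<le> G z \<and>
      exp (- H x \<theta> l g z) * (\<bar>dlam H x \<theta> l g z\<bar> * norm (grad_H H x \<theta> l g z)) \<le> G z \<and>
      exp (- H x \<theta> l g z) * (\<bar>dgam H x \<theta> l g z\<bar> * norm (grad_H H x \<theta> l g z)) \<le> G z \<and>
      exp (- H x \<theta> l g z) * norm (dlam (grad_H H) x \<theta> l g z) \<le> G z \<and>
      exp (- H x \<theta> l g z) * norm (dgam (grad_H H) x \<theta> l g z) \<le> G z"
    using ae
  proof eventually_elim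
    case (elim z)
    show ?case
      using bspec[OF bspec[OF elim, of "th t"], of t] \<epsilon> t
      by (simp add: integrands_le_def Let_def \<theta>_def l_def g_def)
  qed
  have bound: "integrable lborel f"
    if "f \<in> borel_measurable lborel" "AE z in lborel. norm (f z) \<le> G z"
    for f :: "'z \<Rightarrow> 'w::{banach, second_countable_topology}"
    by (rule Bochner_Integration.integrable_bound[OF G that(1)])
      (use that(2) in eventually_elim, force)
  note U' = U[folded \<theta>_def]
  note [simp] = U'
  show "integrable lborel (\<lambda>z. exp (- H x \<theta> l g z) *\<^sub>R grad_H H x \<theta> l g z)"
    by (rule bound, measurable) (use ae' in eventually_elim, simp)
  show "integrable lborel (\<lambda>z. exp (- H x \<theta> l g z) *\<^sub>R hess_H H x \<theta> l g z)"
    by (rule bound, measurable) (use ae' in eventually_elim, simp)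
  have [measurable]: "(\<lambda>z. outer (grad_H H x \<theta> l g z) (grad_H H x \<theta> l g z)) \<in> borel_measurable lborel"
  proof (intro borel_measurable_vec)
    have "(\<lambda>z. grad_H H x \<theta> l g z $ i) \<in> borel_measurable lborel" for i
      by (rule measurable_compose[OF borel_measurable_H(2)[OF U']])
        (intro borel_measurable_continuous_onI continuous_intros)
    then show "(\<lambda>z. outer (grad_H H x \<theta> l g z) (grad_H H x \<theta> l g z) $ i $ j) \<in> borel_measurable lborel" for i j
      by (simp add: outer_def)
  qed
  show "integrable lborel (\<lambda>z. exp (- H x \<theta> l g z) *\<^sub>R outer (grad_H H x \<theta> l g z) (grad_H H x \<theta> l g z))"
    by (rule bound, measurable) (use ae' in eventually_elim, simp add: norm_outer power2_eq_square)
  show "integrable lborel (\<lambda>z. exp (- H x \<theta> l g z) *\<^sub>R dlam H x \<theta> l g z)"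
    by (rule bound, measurable) (use ae' in eventually_elim, simp add: abs_mult)
  show "integrable lborel (\<lambda>z. exp (- H x \<theta> l g z) *\<^sub>R dgam H x \<theta> l g z)"
    by (rule bound, measurable) (use ae' in eventually_elim, simp add: abs_mult)
  show "integrable lborel (\<lambda>z. exp (- H x \<theta> l g z) *\<^sub>R dlam H x \<theta> l g z *\<^sub>R grad_H H x \<theta> l g z)"
    by (rule bound, measurable) (use ae' in eventually_elim, simp add: abs_mult mult.assoc)
  show "integrable lborel (\<lambda>z. exp (- H x \<theta> l g z) *\<^sub>R dgam H x \<theta> l g z *\<^sub>R grad_H H x \<theta> l g z)"
    by (rule bound, measurable) (use ae' in eventually_elim, simp add: abs_mult mult.assoc)
  show "integrable lborel (\<lambda>z. exp (- H x \<theta> l g z) *\<^sub>R dlam (grad_H H) x \<theta> l g z)"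
    by (rule bound, measurable) (use ae' in eventually_elim, simp)
  show "integrable lborel (\<lambda>z. exp (- H x \<theta> l g z) *\<^sub>R dgam (grad_H H) x \<theta> l g z)"
    by (rule bound, measurable) (use ae' in eventually_elim, simp)
qed

text \<open>The covariance arises from \<open>outer_mult_vec\<close>: the scalar
  \<open>gh z \<bullet> v\<close> times \<open>gh z\<close> is a rank-one matrix applied to
  \<open>v\<close>, so averaging it yields a matrix applied to \<open>v\<close>. The choice
  \<open>\<alpha> = \<beta> = 0\<close> serves the derivative in the parameter, and the velocities
  of the path serve the derivative in time.\<close>

lemma gibbs_response_direction:
  fixes th lam gam t
  defines "h \<equiv> H x (th t) (lam t) (gam t)" and "gh \<equiv> grad_H H x (th t) (lam t) (gam t)"
    and "hh \<equiv> hess_H H x (th t) (lam t) (gam t)"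
    and "hl \<equiv> dlam H x (th t) (lam t) (gam t)" and "hg \<equiv> dgam H x (th t) (lam t) (gam t)"
    and "ghl \<equiv> dlam (grad_H H) x (th t) (lam t) (gam t)"
    and "ghg \<equiv> dgam (grad_H H) x (th t) (lam t) (gam t)"
  assumes "th t \<in> U" and "t \<in> {0..1}" and "locally_dominated H th lam gam x t"
  shows "gibbs_response h (\<lambda>z. gh z \<bullet> v + \<alpha> * hl z + \<beta> * hg z)
      (\<lambda>z. hh z *v v + \<alpha> *\<^sub>R ghl z + \<beta> *\<^sub>R ghg z) gh
    = hess_datum_energy H x (th t) (lam t) (gam t) *v v
      + \<alpha> *\<^sub>R gibbs_response h hl ghl gh + \<beta> *\<^sub>R gibbs_response h hg ghg gh"
proof -
  note int = integrable_gibbs_integrands[OF assms(8-), folded assms(1-7)]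
  note bl = bounded_linear_matrix_vector_mult_left[of v]
  note bi = bounded_linear_inner_left[of v]
  note bs = bounded_linear_scaleR_right
  note lin = gibbs_bounded_linear[where h = h]
  have s: "integrable lborel (\<lambda>z. exp (- h z) *\<^sub>R T (\<phi> z))"
    if "bounded_linear T" "integrable lborel (\<lambda>z. exp (- h z) *\<^sub>R \<phi> z)"
    for T :: "'u::{banach, second_countable_topology} \<Rightarrow> 'w::{banach, second_countable_topology}" and \<phi>
    using integrable_bounded_linear[OF that] linear_scale[OF bounded_linear.linear[OF that(1)]]
    by simp
  have add: "integrable lborel (\<lambda>z. exp (- h z) *\<^sub>R (\<phi> z + \<psi> z))"
    if "integrable lborel (\<lambda>z. exp (- h z) *\<^sub>R \<phi> z)" "integrable lborel (\<lambda>z. exp (- h z) *\<^sub>R \<psi> z)"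
    for \<phi> \<psi> :: "'z \<Rightarrow> 'w::{banach, second_countable_topology}"
    using that by (simp add: scaleR_add_right)
  have 1: "gibbs h (\<lambda>z. hh z *v v + \<alpha> *\<^sub>R ghl z + \<beta> *\<^sub>R ghg z)
      = gibbs h hh *v v + \<alpha> *\<^sub>R gibbs h ghl + \<beta> *\<^sub>R gibbs h ghg"
    by (simp only: gibbs_add[OF add[OF s[OF bl int(2)] s[OF bs int(8)]] s[OF bs int(9)]]
        gibbs_add[OF s[OF bl int(2)] s[OF bs int(8)]]
        lin[OF bl int(2)] lin[OF bs int(8)] lin[OF bs int(9)])
  have 2: "gibbs h (\<lambda>z. gh z \<bullet> v + \<alpha> * hl z + \<beta> * hg z)
      = gibbs h gh \<bullet> v + \<alpha> * gibbs h hl + \<beta> * gibbs h hg"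
    by (simp only: real_scaleR_def[symmetric] gibbs_add[OF add[OF s[OF bi int(1)] s[OF bs int(4)]] s[OF bs int(5)]]
        gibbs_add[OF s[OF bi int(1)] s[OF bs int(4)]]
        lin[OF bi int(1)] lin[OF bs int(4)] lin[OF bs int(5)])
  have "gibbs h (\<lambda>z. (gh z \<bullet> v + \<alpha> * hl z + \<beta> * hg z) *\<^sub>R gh z)
      = gibbs h (\<lambda>z. outer (gh z) (gh z) *v v + \<alpha> *\<^sub>R (hl z *\<^sub>R gh z) + \<beta> *\<^sub>R (hg z *\<^sub>R gh z))"
    by (simp add: outer_mult_vec scaleR_add_left)
  also have "\<dots> = gibbs h (\<lambda>z. outer (gh z) (gh z)) *v v + \<alpha> *\<^sub>R gibbs h (\<lambda>z. hl z *\<^sub>R gh z)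
      + \<beta> *\<^sub>R gibbs h (\<lambda>z. hg z *\<^sub>R gh z)"
    by (simp only: gibbs_add[OF add[OF s[OF bl int(3)] s[OF bs int(6)]] s[OF bs int(7)]]
        gibbs_add[OF s[OF bl int(3)] s[OF bs int(6)]]
        lin[OF bl int(3)] lin[OF bs int(6)] lin[OF bs int(7)])
  finally show ?thesis
    unfolding gibbs_response_def hess_datum_energy_def 1 2 assms(1-7)[symmetric]
    by (simp add: matrix_vector_mult_add_rdistrib matrix_vector_mult_diff_rdistrib outer_mult_vec
        algebra_simps)
qed

text \<open>Radius and majorant are chosen before the base point, so the resulting derivative
  formulas hold throughout one ball around \<open>th t\<close>.\<close>

lemma dominated_gibbs_family_parameter:
  assumes U: "th t \<in> U" and t: "t \<in> {0..1}" and dom: "locally_dominated H th lam gam x t"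
  obtains \<delta> G where "\<delta> > 0" "ball (th t) \<delta> \<subseteq> U"
    "\<forall>\<theta>\<in>ball (th t) \<delta>. dominated_gibbs_family (ball (th t) \<delta>) \<theta>
      (\<lambda>\<theta>. H x \<theta> (lam t) (gam t)) (\<lambda>\<theta> z v. grad_H H x \<theta> (lam t) (gam t) z \<bullet> v)
      (\<lambda>\<theta>. grad_H H x \<theta> (lam t) (gam t)) (\<lambda>\<theta> z v. hess_H H x \<theta> (lam t) (gam t) z *v v) G"
proof -
  obtain \<epsilon> G where \<epsilon>: "\<epsilon> > 0" and G: "integrable lborel G"
    and ae: "AE z in lborel. \<forall>\<theta>\<in>ball (th t) \<epsilon>. \<forall>s\<in>ball t \<epsilon> \<inter> {0..1}.
           integrands_le H x \<theta> (lam s) (gam s) z (G z)"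
    using dom by (rule locally_dominatedE)
  obtain \<delta>0 where \<delta>0: "\<delta>0 > 0" "ball (th t) \<delta>0 \<subseteq> U"
    using open_U U openE by blast
  define \<delta> where "\<delta> = min \<delta>0 \<epsilon>"
  have \<delta>: "\<delta> > 0" "ball (th t) \<delta> \<subseteq> U" "ball (th t) \<delta> \<subseteq> ball (th t) \<epsilon>"
    using \<epsilon> \<delta>0 by (auto simp: \<delta>_def)
  show thesis
  proof (rule that[OF \<delta>(1,2)], rule ballI)
    fix \<theta> assume \<theta>: "\<theta> \<in> ball (th t) \<delta>"
    then have U': "\<theta> \<in> U" using \<delta> by auto
    note meas = borel_measurable_H[of _ "lam t" "gam t"]
    show "dominated_gibbs_family (ball (th t) \<delta>) \<theta>
      (\<lambda>\<theta>. H x \<theta> (lam t) (gam t)) (\<lambda>\<theta> z v. grad_H H x \<theta> (lam t) (gam t) z \<bullet> v)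
      (\<lambda>\<theta>. grad_H H x \<theta> (lam t) (gam t)) (\<lambda>\<theta> z v. hess_H H x \<theta> (lam t) (gam t) z *v v) G"
    proof
      show "AE z in lborel. \<forall>\<theta>\<in>ball (th t) \<delta>.
        ((\<lambda>\<theta>. H x \<theta> (lam t) (gam t) z) has_derivative (\<lambda>v. grad_H H x \<theta> (lam t) (gam t) z \<bullet> v))
          (at \<theta> within ball (th t) \<delta>) \<and>
        ((\<lambda>\<theta>. grad_H H x \<theta> (lam t) (gam t) z) has_derivative (\<lambda>v. hess_H H x \<theta> (lam t) (gam t) z *v v))
          (at \<theta> within ball (th t) \<delta>) \<and>
        exp (- H x \<theta> (lam t) (gam t) z) \<le> G z \<and>
        exp (- H x \<theta> (lam t) (gam t) z) * norm (grad_H H x \<theta> (lam t) (gam t) z) \<le> G z \<and>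
        (\<forall>v. exp (- H x \<theta> (lam t) (gam t) z) * \<bar>grad_H H x \<theta> (lam t) (gam t) z \<bullet> v\<bar> \<le> G z * norm v \<and>
             exp (- H x \<theta> (lam t) (gam t) z) * norm (hess_H H x \<theta> (lam t) (gam t) z *v v) \<le> G z * norm v \<and>
             exp (- H x \<theta> (lam t) (gam t) z) * (\<bar>grad_H H x \<theta> (lam t) (gam t) z \<bullet> v\<bar>
                * norm (grad_H H x \<theta> (lam t) (gam t) z)) \<le> G z * norm v)"
        using ae
      proof eventually_elim
        case (elim z)
        show ?case
        proof (intro ballI)
          fix \<theta> assume \<theta>: "\<theta> \<in> ball (th t) \<delta>"
          define w a where "w = exp (- H x \<theta> (lam t) (gam t) z)" and "a = grad_H H x \<theta> (lam t) (gam t) z"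
          define hh where "hh = hess_H H x \<theta> (lam t) (gam t) z"
          \<comment> \<open>Instantiating the domination at time \<open>t\<close> freezes the
            multipliers while the parameter varies.\<close>
          have b: "w \<le> G z" "w * norm a \<le> G z" "w * (norm a)\<^sup>2 \<le> G z" "w * norm hh \<le> G z"
            using bspec[OF bspec[OF elim, of \<theta>], of t] \<theta> \<delta> \<epsilon> t
            by (auto simp: integrands_le_def Let_def w_def a_def hh_def)
          have w0: "w \<ge> 0" by (simp add: w_def)
          \<comment> \<open>Cauchy-Schwarz, or its matrix version, splits off \<open>norm v\<close>;
            what remains is one of the bounds in \<open>b\<close>, with the squared gradient norm
            used in the third claim.\<close>
          have "w * \<bar>a \<bullet> v\<bar> \<le> G z * norm v \<and> w * norm (hh *v v) \<le> G z * norm v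
              \<and> w * (\<bar>a \<bullet> v\<bar> * norm a) \<le> G z * norm v" for v
          proof (intro conjI)
            show "w * \<bar>a \<bullet> v\<bar> \<le> G z * norm v"
              using mult_left_mono[OF Cauchy_Schwarz_ineq2[of a v] w0]
                mult_right_mono[OF b(2) norm_ge_zero[of v]] by (simp add: mult.assoc)
            show "w * norm (hh *v v) \<le> G z * norm v"
              using mult_left_mono[OF matrix_vector_mult_norm_le[of hh v] w0]
                mult_right_mono[OF b(4) norm_ge_zero[of v]] by (simp add: mult.assoc)
            show "w * (\<bar>a \<bullet> v\<bar> * norm a) \<le> G z * norm v"
              using mult_left_mono[OF mult_right_mono[OF Cauchy_Schwarz_ineq2[of a v] norm_ge_zero[of a]] w0]
                mult_right_mono[OF b(3) norm_ge_zero[of v]] by (simp add: ac_simps power2_eq_square)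
          qed
          then show "((\<lambda>\<theta>. H x \<theta> (lam t) (gam t) z) has_derivative (\<lambda>v. grad_H H x \<theta> (lam t) (gam t) z \<bullet> v))
            (at \<theta> within ball (th t) \<delta>) \<and>
          ((\<lambda>\<theta>. grad_H H x \<theta> (lam t) (gam t) z) has_derivative (\<lambda>v. hess_H H x \<theta> (lam t) (gam t) z *v v))
            (at \<theta> within ball (th t) \<delta>) \<and>
          exp (- H x \<theta> (lam t) (gam t) z) \<le> G z \<and>
          exp (- H x \<theta> (lam t) (gam t) z) * norm (grad_H H x \<theta> (lam t) (gam t) z) \<le> G z \<and>
          (\<forall>v. exp (- H x \<theta> (lam t) (gam t) z) * \<bar>grad_H H x \<theta> (lam t) (gam t) z \<bullet> v\<bar> \<le> G z * norm v \<and>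
               exp (- H x \<theta> (lam t) (gam t) z) * norm (hess_H H x \<theta> (lam t) (gam t) z *v v) \<le> G z * norm v \<and>
               exp (- H x \<theta> (lam t) (gam t) z) * (\<bar>grad_H H x \<theta> (lam t) (gam t) z \<bullet> v\<bar>
                  * norm (grad_H H x \<theta> (lam t) (gam t) z)) \<le> G z * norm v)"
            using b(1,2) has_derivative_at_withinI[OF has_derivative_H] has_derivative_at_withinI[OF has_derivative_grad_H]
              subsetD[OF \<delta>(2) \<theta>]
            unfolding w_def a_def hh_def by blast
        qed
      qed
      show "(\<lambda>z. hess_H H x \<theta> (lam t) (gam t) z *v v) \<in> borel_measurable lborel" for v
        by (rule measurable_compose[OF meas(3)[OF U'] borel_measurable_continuous_onI])
          (rule linear_continuous_on[OF bounded_linear_matrix_vector_mult_left])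
      show "(\<lambda>z. grad_H H x \<theta> (lam t) (gam t) z \<bullet> v) \<in> borel_measurable lborel" for v
        by (intro borel_measurable_inner meas(2)[OF U'] borel_measurable_const)
      show "H x \<theta> (lam t) (gam t) \<in> borel_measurable lborel"
        "grad_H H x \<theta> (lam t) (gam t) \<in> borel_measurable lborel" if "\<theta> \<in> ball (th t) \<delta>" for \<theta>
        using meas(1,2) subsetD[OF \<delta>(2) that] by blast+
    qed (fact convex_ball \<theta> G)+
  qed
qed

text \<open>The first claim is needed near \<open>th t\<close> and not only at it: it supplies the
  gradient of the energy as a function, which the second claim then differentiates.\<close>

lemma has_derivative_gibbs_parameter:
  assumes U: "th t \<in> U" and t: "t \<in> {0..1}" and dom: "locally_dominated H th lam gam x t"
  shows "eventually (\<lambda>\<theta>. ((\<lambda>\<theta>. ln (partition_fun (H x \<theta> (lam t) (gam t)))) has_derivative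
      (\<lambda>v. - (gibbs (H x \<theta> (lam t) (gam t)) (grad_H H x \<theta> (lam t) (gam t)) \<bullet> v))) (at \<theta>)) (nhds (th t))"
    and "((\<lambda>\<theta>. gibbs (H x \<theta> (lam t) (gam t)) (grad_H H x \<theta> (lam t) (gam t))) has_derivative
      (\<lambda>v. hess_datum_energy H x (th t) (lam t) (gam t) *v v)) (at (th t))"
proof -
  obtain \<delta> G where \<delta>: "\<delta> > 0" and "ball (th t) \<delta> \<subseteq> U" and fam: "\<forall>\<theta>\<in>ball (th t) \<delta>. dominated_gibbs_family (ball (th t) \<delta>) \<theta>
      (\<lambda>\<theta>. H x \<theta> (lam t) (gam t)) (\<lambda>\<theta> z v. grad_H H x \<theta> (lam t) (gam t) z \<bullet> v)
      (\<lambda>\<theta>. grad_H H x \<theta> (lam t) (gam t)) (\<lambda>\<theta> z v. hess_H H x \<theta> (lam t) (gam t) z *v v) G"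
    by (rule dominated_gibbs_family_parameter[OF assms])
  have "((\<lambda>\<theta>. ln (partition_fun (H x \<theta> (lam t) (gam t)))) has_derivative
      (\<lambda>v. - (gibbs (H x \<theta> (lam t) (gam t)) (grad_H H x \<theta> (lam t) (gam t)) \<bullet> v))) (at \<theta>)"
    if \<theta>: "\<theta> \<in> ball (th t) \<delta>" for \<theta>
  proof -
    interpret F: dominated_gibbs_family "ball (th t) \<delta>" \<theta> "\<lambda>\<theta>. H x \<theta> (lam t) (gam t)"
      "\<lambda>\<theta> z v. grad_H H x \<theta> (lam t) (gam t) z \<bullet> v" "\<lambda>\<theta>. grad_H H x \<theta> (lam t) (gam t)"
      "\<lambda>\<theta> z v. hess_H H x \<theta> (lam t) (gam t) z *v v" G
      by (rule bspec[OF fam \<theta>])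
    have "gibbs (H x \<theta> (lam t) (gam t)) (\<lambda>z. grad_H H x \<theta> (lam t) (gam t) z \<bullet> v)
        = gibbs (H x \<theta> (lam t) (gam t)) (grad_H H x \<theta> (lam t) (gam t)) \<bullet> v" for v
      using F.integrable_weight_observable[OF \<theta>]
      by (rule gibbs_bounded_linear[OF bounded_linear_inner_left])
    then show ?thesis
      using F.has_derivative_ln_partition_fun unfolding at_within_open[OF \<theta> open_ball] by (simp only:)
  qed
  then show "eventually (\<lambda>\<theta>. ((\<lambda>\<theta>. ln (partition_fun (H x \<theta> (lam t) (gam t)))) has_derivative
      (\<lambda>v. - (gibbs (H x \<theta> (lam t) (gam t)) (grad_H H x \<theta> (lam t) (gam t)) \<bullet> v))) (at \<theta>)) (nhds (th t))"
    using eventually_nhds_in_open[OF open_ball, of "th t" "th t" \<delta>] \<delta> by (auto elim: eventually_mono)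
  have t0: "th t \<in> ball (th t) \<delta>" using \<delta> by simp
  interpret F: dominated_gibbs_family "ball (th t) \<delta>" "th t" "\<lambda>\<theta>. H x \<theta> (lam t) (gam t)"
      "\<lambda>\<theta> z v. grad_H H x \<theta> (lam t) (gam t) z \<bullet> v" "\<lambda>\<theta>. grad_H H x \<theta> (lam t) (gam t)"
      "\<lambda>\<theta> z v. hess_H H x \<theta> (lam t) (gam t) z *v v" G
    by (rule bspec[OF fam t0])
  have direction: "gibbs_response (H x (th t) (lam t) (gam t)) (\<lambda>z. grad_H H x (th t) (lam t) (gam t) z \<bullet> v)
      (\<lambda>z. hess_H H x (th t) (lam t) (gam t) z *v v) (grad_H H x (th t) (lam t) (gam t))
    = hess_datum_energy H x (th t) (lam t) (gam t) *v v" for v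
    using gibbs_response_direction[OF assms, of v 0 0] by (simp only: mult_zero_left scaleR_zero_left add_0_right)
  show "((\<lambda>\<theta>. gibbs (H x \<theta> (lam t) (gam t)) (grad_H H x \<theta> (lam t) (gam t))) has_derivative
      (\<lambda>v. hess_datum_energy H x (th t) (lam t) (gam t) *v v)) (at (th t))"
    using F.has_derivative_gibbs unfolding at_within_open[OF t0 open_ball] direction .
qed

text \<open>Time itself is the parameter of the dominated family. Every value of the multipliers
  that occurs then lies on the path, where the domination is assumed.\<close>

lemma has_vector_derivative_gibbs_path:
  fixes lam gam lamd gamd :: "real \<Rightarrow> real" and th thd :: "real \<Rightarrow> real^'n"
  assumes t: "t \<in> {0..1}" and dom: "locally_dominated H th lam gam x t"
    and U: "th ` {0..1} \<subseteq> U"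
    and th: "\<And>s. s \<in> {0..1} \<Longrightarrow> (th has_vector_derivative thd s) (at s within {0..1})"
    and lam: "\<And>s. s \<in> {0..1} \<Longrightarrow> (lam has_vector_derivative lamd s) (at s within {0..1})"
    and gam: "\<And>s. s \<in> {0..1} \<Longrightarrow> (gam has_vector_derivative gamd s) (at s within {0..1})"
    and bd: "bounded (thd ` {0..1})" "bounded (lamd ` {0..1})" "bounded (gamd ` {0..1})"
  defines "h \<equiv> H x (th t) (lam t) (gam t)" and "gh \<equiv> grad_H H x (th t) (lam t) (gam t)"
  shows "((\<lambda>s. gibbs (H x (th s) (lam s) (gam s)) (grad_H H x (th s) (lam s) (gam s))) has_vector_derivative
      hess_datum_energy H x (th t) (lam t) (gam t) *v thd t
      + lamd t *\<^sub>R gibbs_response h (dlam H x (th t) (lam t) (gam t)) (dlam (grad_H H) x (th t) (lam t) (gam t)) gh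
      + gamd t *\<^sub>R gibbs_response h (dgam H x (th t) (lam t) (gam t)) (dgam (grad_H H) x (th t) (lam t) (gam t)) gh)
    (at t within {0..1})"
proof -
  obtain V1 V2 V3 where V0: "\<And>s. s \<in> {0..1} \<Longrightarrow> norm (thd s) \<le> V1 \<and> \<bar>lamd s\<bar> \<le> V2 \<and> \<bar>gamd s\<bar> \<le> V3"
    using bd unfolding bounded_iff by (metis image_eqI real_norm_def)
  \<comment> \<open>A common bound for the three velocities. The maximum with 1 makes
    \<open>G z \<le> 3 * V * G z\<close>, so the same majorant also covers the undifferentiated
    integrands.\<close>
  define V where "V = max 1 (max V1 (max V2 V3))"
  have V1: "V \<ge> 1" and V: "\<And>s. s \<in> {0..1} \<Longrightarrow> norm (thd s) \<le> V \<and> \<bar>lamd s\<bar> \<le> V \<and> \<bar>gamd s\<bar> \<le> V"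
    using V0 unfolding V_def by force+
  obtain \<epsilon> G where \<epsilon>: "\<epsilon> > 0" and G: "integrable lborel G"
    and ae: "AE z in lborel. \<forall>\<theta>\<in>ball (th t) \<epsilon>. \<forall>s\<in>ball t \<epsilon> \<inter> {0..1}.
           integrands_le H x \<theta> (lam s) (gam s) z (G z)"
    using dom by (rule locally_dominatedE)
  have "continuous (at t within {0..1}) th"
    using th[OF t] by (rule has_vector_derivative_continuous)
  then obtain \<delta>0 where \<delta>0: "\<delta>0 > 0" "\<And>s. s \<in> {0..1} \<Longrightarrow> dist s t < \<delta>0 \<Longrightarrow> dist (th s) (th t) < \<epsilon>"
    using \<epsilon> unfolding continuous_within_eps_delta by blast
  define \<delta> where "\<delta> = min \<delta>0 \<epsilon>"
  \<comment> \<open>The window is short enough that both \<open>s\<close> and \<open>th s\<close>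
    stay in the balls of the domination, and it is convex as an intersection of intervals.\<close>
  define T where "T = {0..1} \<inter> ball t \<delta>"
  have tT: "t \<in> T" using t \<epsilon> \<delta>0 by (simp add: T_def \<delta>_def)
  have T: "s \<in> {0..1}" "th s \<in> ball (th t) \<epsilon>" "s \<in> ball t \<epsilon> \<inter> {0..1}" "th s \<in> U" if "s \<in> T" for s
    using that \<delta>0 U by (auto simp: T_def \<delta>_def dist_commute)
  have der: "(th has_vector_derivative thd s) (at s within T)"
    "(lam has_vector_derivative lamd s) (at s within T)"
    "(gam has_vector_derivative gamd s) (at s within T)" if "s \<in> T" for s
    using th lam gam T(1)[OF that] by (auto simp: T_def intro: has_vector_derivative_within_subset)
  have sub: "th ` T \<subseteq> U" using T by auto
  define k where "k s z = grad_H H x (th s) (lam s) (gam s) z \<bullet> thd s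
    + lamd s * dlam H x (th s) (lam s) (gam s) z + gamd s * dgam H x (th s) (lam s) (gam s) z" for s z
  define u where "u s z = hess_H H x (th s) (lam s) (gam s) z *v thd s
    + lamd s *\<^sub>R dlam (grad_H H) x (th s) (lam s) (gam s) z
    + gamd s *\<^sub>R dgam (grad_H H) x (th s) (lam s) (gam s) z" for s z
  note meas = borel_measurable_H[of "th _"]
  have mh: "(\<lambda>z. hess_H H x (th t) (lam t) (gam t) z *v v) \<in> borel_measurable lborel" for v
    by (rule measurable_compose[OF meas(3)[OF T(4)[OF tT]] borel_measurable_continuous_onI])
      (rule linear_continuous_on[OF bounded_linear_matrix_vector_mult_left])
  interpret F: dominated_gibbs_family T t "\<lambda>s. H x (th s) (lam s) (gam s)" "\<lambda>s z v. v * k s z"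
    "\<lambda>s. grad_H H x (th s) (lam s) (gam s)" "\<lambda>s z v. v *\<^sub>R u s z" "\<lambda>z. 3 * V * G z"
  proof
    show "convex T" by (auto simp: T_def intro: convex_Int)
    show "t \<in> T" by (rule tT)
    show "H x (th s) (lam s) (gam s) \<in> borel_measurable lborel"
      "grad_H H x (th s) (lam s) (gam s) \<in> borel_measurable lborel" if "s \<in> T" for s
      using meas(1,2)[OF T(4)[OF that]] by auto
    show "(\<lambda>z. v * k t z) \<in> borel_measurable lborel" "(\<lambda>z. v *\<^sub>R u t z) \<in> borel_measurable lborel" for v
      unfolding k_def u_def using meas[OF T(4)[OF tT]] mh
      by (auto intro!: borel_measurable_times borel_measurable_add borel_measurable_scaleR borel_measurable_inner)
    show "integrable lborel (\<lambda>z. 3 * V * G z)" using G by simp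
    show "AE z in lborel. \<forall>s\<in>T.
        ((\<lambda>s. H x (th s) (lam s) (gam s) z) has_derivative (\<lambda>v. v * k s z)) (at s within T) \<and>
        ((\<lambda>s. grad_H H x (th s) (lam s) (gam s) z) has_derivative (\<lambda>v. v *\<^sub>R u s z)) (at s within T) \<and>
        exp (- H x (th s) (lam s) (gam s) z) \<le> 3 * V * G z \<and>
        exp (- H x (th s) (lam s) (gam s) z) * norm (grad_H H x (th s) (lam s) (gam s) z) \<le> 3 * V * G z \<and>
        (\<forall>v. exp (- H x (th s) (lam s) (gam s) z) * \<bar>v * k s z\<bar> \<le> 3 * V * G z * norm v \<and>
             exp (- H x (th s) (lam s) (gam s) z) * norm (v *\<^sub>R u s z) \<le> 3 * V * G z * norm v \<and>
             exp (- H x (th s) (lam s) (gam s) z) * (\<bar>v * k s z\<bar>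
                * norm (grad_H H x (th s) (lam s) (gam s) z)) \<le> 3 * V * G z * norm v)"
      using ae
    proof eventually_elim
      case (elim z)
      show ?case
      proof (intro ballI)
        fix s assume s: "s \<in> T"
        define w A L C where "w = exp (- H x (th s) (lam s) (gam s) z)"
          and "A = grad_H H x (th s) (lam s) (gam s) z"
          and "L = dlam H x (th s) (lam s) (gam s) z" and "C = dgam H x (th s) (lam s) (gam s) z"
        define AA AL AC where "AA = hess_H H x (th s) (lam s) (gam s) z"
          and "AL = dlam (grad_H H) x (th s) (lam s) (gam s) z"
          and "AC = dgam (grad_H H) x (th s) (lam s) (gam s) z"
        have b: "w \<le> G z" "w * norm A \<le> G z" "w * (norm A)\<^sup>2 \<le> G z" "w * norm AA \<le> G z"
          "w * \<bar>L\<bar> \<le> G z" "w * \<bar>C\<bar> \<le> G z" "w * (\<bar>L\<bar> * norm A) \<le> G z" "w * (\<bar>C\<bar> * norm A) \<le> G z"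
          "w * norm AL \<le> G z" "w * norm AC \<le> G z"
          using bspec[OF bspec[OF elim T(2)[OF s]] T(3)[OF s]]
          by (auto simp: integrands_le_def Let_def w_def A_def L_def C_def AA_def AL_def AC_def)
        have w0: "w \<ge> 0" by (simp add: w_def)
        then have G0: "G z \<ge> 0" using b(1) by simp
        note Vs = V[OF T(1)[OF s]]
        have "\<bar>k s z\<bar> \<le> \<bar>A \<bullet> thd s\<bar> + \<bar>lamd s * L\<bar> + \<bar>gamd s * C\<bar>"
          unfolding k_def A_def L_def C_def by linarith
        also have "\<dots> \<le> norm A * V + \<bar>L\<bar> * V + \<bar>C\<bar> * V"
        proof (intro add_mono)
          show "\<bar>A \<bullet> thd s\<bar> \<le> norm A * V"
            using Cauchy_Schwarz_ineq2[of A "thd s"] mult_left_mono[of "norm (thd s)" V "norm A"] Vs by simp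
        qed (use Vs in \<open>simp_all add: abs_mult mult.commute[of _ V] mult_right_mono\<close>)
        finally have k: "\<bar>k s z\<bar> \<le> V * (norm A + \<bar>L\<bar> + \<bar>C\<bar>)"
          by (simp add: algebra_simps)
        have "norm (u s z) \<le> norm (AA *v thd s) + norm (lamd s *\<^sub>R AL) + norm (gamd s *\<^sub>R AC)"
          unfolding u_def AA_def AL_def AC_def by (intro norm_triangle_le add_right_mono norm_triangle_ineq)
        also have "\<dots> \<le> norm AA * V + norm AL * V + norm AC * V"
        proof (intro add_mono)
          show "norm (AA *v thd s) \<le> norm AA * V"
            using matrix_vector_mult_norm_le[of AA "thd s"] mult_left_mono[of "norm (thd s)" V "norm AA"] Vs by simp
        qed (use Vs in \<open>simp_all add: mult.commute[of _ V] mult_right_mono\<close>)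
        finally have u: "norm (u s z) \<le> V * (norm AA + norm AL + norm AC)"
          by (simp add: algebra_simps)
        \<comment> \<open>The factor 3 counts the contributions of the parameter and of the two
          multipliers to each velocity.\<close>
        have V3: "V * (p + q + r) \<le> 3 * V * G z" if "p \<le> G z" "q \<le> G z" "r \<le> G z" for p q r
          using mult_left_mono[of "p + q + r" "3 * G z" V] that V1 by simp
        have "w * \<bar>k s z\<bar> \<le> w * (V * (norm A + \<bar>L\<bar> + \<bar>C\<bar>))"
          using k w0 by (rule mult_left_mono)
        also have "\<dots> = V * (w * norm A + w * \<bar>L\<bar> + w * \<bar>C\<bar>)" by (simp add: algebra_simps)
        also have "\<dots> \<le> 3 * V * G z" using b by (intro V3)
        finally have 1: "w * \<bar>k s z\<bar> \<le> 3 * V * G z" .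
        have "w * norm (u s z) \<le> w * (V * (norm AA + norm AL + norm AC))"
          using u w0 by (rule mult_left_mono)
        also have "\<dots> = V * (w * norm AA + w * norm AL + w * norm AC)" by (simp add: algebra_simps)
        also have "\<dots> \<le> 3 * V * G z" using b by (intro V3)
        finally have 2: "w * norm (u s z) \<le> 3 * V * G z" .
        have "w * (\<bar>k s z\<bar> * norm A) \<le> w * (V * (norm A + \<bar>L\<bar> + \<bar>C\<bar>) * norm A)"
          using k w0 by (intro mult_left_mono mult_right_mono) auto
        also have "\<dots> = V * (w * (norm A)\<^sup>2 + w * (\<bar>L\<bar> * norm A) + w * (\<bar>C\<bar> * norm A))"
          by (simp add: algebra_simps power2_eq_square)
        also have "\<dots> \<le> 3 * V * G z" using b by (intro V3)
        finally have 3: "w * (\<bar>k s z\<bar> * norm A) \<le> 3 * V * G z" .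
        have "G z \<le> 3 * V * G z" using mult_right_mono[of 1 "3 * V" "G z"] V1 G0 by simp
        then have 4: "w \<le> 3 * V * G z" "w * norm A \<le> 3 * V * G z" using b by auto
        have "w * \<bar>v * k s z\<bar> \<le> 3 * V * G z * norm v \<and> w * norm (v *\<^sub>R u s z) \<le> 3 * V * G z * norm v
          \<and> w * (\<bar>v * k s z\<bar> * norm A) \<le> 3 * V * G z * norm v" for v
          using mult_right_mono[OF 1 abs_ge_zero[of v]] mult_right_mono[OF 2 abs_ge_zero[of v]]
            mult_right_mono[OF 3 abs_ge_zero[of v]]
          by (simp add: abs_mult ac_simps)
        then show "((\<lambda>s. H x (th s) (lam s) (gam s) z) has_derivative (\<lambda>v. v * k s z)) (at s within T) \<and>
          ((\<lambda>s. grad_H H x (th s) (lam s) (gam s) z) has_derivative (\<lambda>v. v *\<^sub>R u s z)) (at s within T) \<and>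
          exp (- H x (th s) (lam s) (gam s) z) \<le> 3 * V * G z \<and>
          exp (- H x (th s) (lam s) (gam s) z) * norm (grad_H H x (th s) (lam s) (gam s) z) \<le> 3 * V * G z \<and>
          (\<forall>v. exp (- H x (th s) (lam s) (gam s) z) * \<bar>v * k s z\<bar> \<le> 3 * V * G z * norm v \<and>
               exp (- H x (th s) (lam s) (gam s) z) * norm (v *\<^sub>R u s z) \<le> 3 * V * G z * norm v \<and>
               exp (- H x (th s) (lam s) (gam s) z) * (\<bar>v * k s z\<bar>
                  * norm (grad_H H x (th s) (lam s) (gam s) z)) \<le> 3 * V * G z * norm v)"
          using has_derivative_H_path[OF der[OF s] s sub, of z, folded k_def u_def] 4
          unfolding w_def A_def by blast
      qed
    qed
  qed
  let ?Q = "\<lambda>s. gibbs (H x (th s) (lam s) (gam s)) (grad_H H x (th s) (lam s) (gam s))"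
  \<comment> \<open>Homogeneity of the response turns the derivative as a linear map of the time
    increment into a velocity vector.\<close>
  have scale: "gibbs_response h (\<lambda>z. v * k t z) (\<lambda>z. v *\<^sub>R u t z) gh = v *\<^sub>R gibbs_response h (k t) (u t) gh" for v
    using gibbs_scaleR[of h v "k t"] gibbs_scaleR[of h v "u t"] gibbs_scaleR[of h v "\<lambda>z. k t z *\<^sub>R gh z"]
    by (simp add: gibbs_response_def scaleR_add_right scaleR_diff_right)
  have "(?Q has_vector_derivative gibbs_response h (k t) (u t) gh) (at t within T)"
    using F.has_derivative_gibbs scale unfolding has_vector_derivative_def h_def gh_def by simp
  \<comment> \<open>Derivatives are local: cutting the unit interval down to a ball around
    \<open>t\<close> leaves the filter unchanged, also at the end points.\<close>
  moreover have "at t within T = at t within {0..1}"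
    by (rule at_within_nhd[of t "ball t \<delta>"]) (use \<delta>0(1) \<epsilon> in \<open>auto simp: T_def \<delta>_def\<close>)
  ultimately have "(?Q has_vector_derivative gibbs_response h (k t) (u t) gh) (at t within {0..1})"
    by (simp only:)
  then show ?thesis
    unfolding k_def[abs_def] u_def[abs_def] h_def gh_def gibbs_response_direction[OF T(4)[OF tT] t dom] .
qed

end

section \<open>Averaging over the data\<close>

text \<open>Neither the sign of \<open>q\<close> nor any property of \<open>f\<close> enters, so the
  same sum formula serves the data distribution and its signed time derivative.\<close>

lemma mass_integral_finite_support:
  assumes "finite S" "{x. q x \<noteq> 0} \<subseteq> S"
  shows "mass_integral q f = (\<Sum>x\<in>S. q x *\<^sub>R f x)"
proof -
  have sub: "{x \<in> UNIV. q x *\<^sub>R f x \<noteq> 0} \<subseteq> S" using assms(2) by auto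
  have "mass_integral q f = (\<Sum>x\<in>{x \<in> UNIV. q x *\<^sub>R f x \<noteq> 0}. q x *\<^sub>R f x)"
    unfolding mass_integral_def
    using finite_subset[OF sub assms(1)] by (subst lebesgue_integral_count_space_finite_support) auto
  also have "\<dots> = (\<Sum>x\<in>S. q x *\<^sub>R f x)"
    by (rule sum.mono_neutral_left) (use assms sub in auto)
  finally show ?thesis .
qed

lemma set_pmf_empirical: "n > 0 \<Longrightarrow> set_pmf (empirical n xs) = xs ` {1..n}"
  by (simp add: empirical_def)

lemma has_field_derivative_data_mass:
  "((\<lambda>t. data_mass ps pt x t) has_field_derivative (pmf pt x - pmf ps x)) (at t within T)"
  unfolding data_mass_def by (auto intro!: derivative_eq_intros)

text \<open>Uniqueness of derivatives within the unit interval identifies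
  \<open>vector_derivative\<close> with \<open>D [1]\<close>. The latter is itself differentiable,
  hence continuous, hence bounded on a compact set.\<close>

lemma smooth_on_unit_interval:
  fixes f :: "real \<Rightarrow> 'b::real_normed_vector"
  assumes "smooth_on {0..1} f"
  shows "t \<in> {0..1} \<Longrightarrow> (f has_vector_derivative vector_derivative f (at t within {0..1})) (at t within {0..1})"
    and "bounded ((\<lambda>t. vector_derivative f (at t within {0..1})) ` {0..1})"
proof -
  obtain D where D0: "\<And>x. x \<in> {0..1} \<Longrightarrow> D [] x = f x"
    and D: "\<And>vs x. x \<in> {0..1} \<Longrightarrow> (D vs has_derivative (\<lambda>v. D (v # vs) x)) (at x within {0..1})"
    using assms unfolding smooth_on_def by metis
  have f: "(f has_vector_derivative D [1] x) (at x within {0..1})" if x: "x \<in> {0..1}" for x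
  proof -
    have "(f has_derivative (\<lambda>v. D [v] x)) (at x within {0..1})"
      by (rule has_derivative_transform[OF x _ D[OF x]]) (simp add: D0)
    moreover have "(\<lambda>v. D [v] x) = (\<lambda>v. v *\<^sub>R D [1] x)"
    proof
      show "D [v] x = v *\<^sub>R D [1] x" for v
        using linear_scale[OF has_derivative_linear[OF D[OF x, of "[]"]], of v 1] by simp
    qed
    ultimately show ?thesis by (simp only: has_vector_derivative_def)
  qed
  then have eq: "vector_derivative f (at x within {0..1}) = D [1] x" if "x \<in> {0..1}" for x
    using vector_derivative_within_cbox[of 0 1 x f "D [1] x"] that by (simp add: cbox_interval)
  show "t \<in> {0..1} \<Longrightarrow> (f has_vector_derivative vector_derivative f (at t within {0..1})) (at t within {0..1})"
    using f eq by simp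
  have "continuous_on {0..1} (D [1])"
    using D has_derivative_continuous continuous_on_eq_continuous_within by blast
  then have "bounded (D [1] ` {0..1})"
    by (intro compact_imp_bounded compact_continuous_image) auto
  then show "bounded ((\<lambda>t. vector_derivative f (at t within {0..1})) ` {0..1})"
    by (simp only: eq cong: image_cong)
qed

lemma affine_hamiltonian_hamiltonian:
  fixes m :: "real^'n \<Rightarrow> 'z::euclidean_space \<Rightarrow> real"
    and d :: "real^'n \<Rightarrow> 'x \<Rightarrow> 'z \<Rightarrow> real" and c :: "real^'n \<Rightarrow> 'y \<Rightarrow> 'z \<Rightarrow> real"
  assumes "open U"
    and "\<And>\<theta>. \<theta> \<in> U \<Longrightarrow> m \<theta> \<in> borel_measurable lborel"
      "\<And>\<theta>. \<theta> \<in> U \<Longrightarrow> d \<theta> x \<in> borel_measurable lborel"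
      "\<And>\<theta>. \<theta> \<in> U \<Longrightarrow> c \<theta> (lab x) \<in> borel_measurable lborel"
    and "\<And>\<theta> z. \<theta> \<in> U \<Longrightarrow> m \<theta> z > 0" "\<And>\<theta> z. \<theta> \<in> U \<Longrightarrow> d \<theta> x z > 0"
      "\<And>\<theta> z. \<theta> \<in> U \<Longrightarrow> c \<theta> (lab x) z > 0"
    and "\<And>z. smooth_on U (\<lambda>\<theta>. m \<theta> z)" "\<And>z. smooth_on U (\<lambda>\<theta>. d \<theta> x z)"
      "\<And>z. smooth_on U (\<lambda>\<theta>. c \<theta> (lab x) z)"
  shows "affine_hamiltonian U (hamiltonian m d c lab) x
    (\<lambda>\<theta> z. - ln (m \<theta> z)) (\<lambda>\<theta> z. - ln (d \<theta> x z)) (\<lambda>\<theta> z. - ln (c \<theta> (lab x) z))"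
proof
  show "(\<lambda>\<theta>. - ln (m \<theta> z)) twice_differentiable_on U" "(\<lambda>\<theta>. - ln (d \<theta> x z)) twice_differentiable_on U"
    "(\<lambda>\<theta>. - ln (c \<theta> (lab x) z)) twice_differentiable_on U" for z
    by (intro twice_differentiable_on_minus twice_differentiable_on_ln
        smooth_on_imp_twice_differentiable_on; fact assms)+
qed (use assms(1-4) in \<open>auto simp: hamiltonian_def\<close>)

section \<open>The velocity of a quasi-static path of equilibria\<close>

theorem lemma9:
  fixes \<Theta> U :: "(real^'n) set"
    and MX :: "'x measure" and MY :: "'y measure"
    and m :: "real^'n \<Rightarrow> 'z::euclidean_space \<Rightarrow> real"
    and d :: "real^'n \<Rightarrow> 'x \<Rightarrow> 'z \<Rightarrow> real"
    and c :: "real^'n \<Rightarrow> 'y \<Rightarrow> 'z \<Rightarrow> real"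
    and lab :: "'x \<Rightarrow> 'y"
    and ns nt :: nat and xs xt :: "nat \<Rightarrow> 'x"
    and lam gam :: "real \<Rightarrow> real" and th :: "real \<Rightarrow> real^'n"
  defines "p \<equiv> data_mass (empirical ns xs) (empirical nt xt)"
    and "S \<equiv> xs ` {1..ns} \<union> xt ` {1..nt}"
    and "H \<equiv> hamiltonian m d c lab"
  defines "J \<equiv> free_energy p H"
    and "lamdot \<equiv> (\<lambda>t. vector_derivative lam (at t within {0..1}))"
    and "gamdot \<equiv> (\<lambda>t. vector_derivative gam (at t within {0..1}))"
    and "thdot \<equiv> (\<lambda>t. vector_derivative th (at t within {0..1}))"
    \<comment> \<open>the Hamiltonian and its derivatives, evaluated along the path\<close>
    and "h \<equiv> (\<lambda>x t. H x (th t) (lam t) (gam t))"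
    and "gh \<equiv> (\<lambda>x t. grad_H H x (th t) (lam t) (gam t))"
    and "hh \<equiv> (\<lambda>x t. hess_H H x (th t) (lam t) (gam t))"
    and "hl \<equiv> (\<lambda>x t. dlam H x (th t) (lam t) (gam t))"
    and "hg \<equiv> (\<lambda>x t. dgam H x (th t) (lam t) (gam t))"
    and "ghl \<equiv> (\<lambda>x t. dlam (grad_H H) x (th t) (lam t) (gam t))"
    and "ghg \<equiv> (\<lambda>x t. dgam (grad_H H) x (th t) (lam t) (gam t))"
  defines "A \<equiv> (\<lambda>t. hessian (\<lambda>\<theta>. J \<theta> (lam t) (gam t) t) (th t))"
    and "b_lam \<equiv> (\<lambda>t. - mass_integral (\<lambda>x. p x t) (\<lambda>x.
             gibbs (h x t) (ghl x t)
           - gibbs (h x t) (\<lambda>z. hl x t z *\<^sub>R gh x t z)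
           + gibbs (h x t) (hl x t) *\<^sub>R gibbs (h x t) (gh x t)))"
    and "b_gam \<equiv> (\<lambda>t. - mass_integral (\<lambda>x. p x t) (\<lambda>x.
             gibbs (h x t) (ghg x t)
           - gibbs (h x t) (\<lambda>z. hg x t z *\<^sub>R gh x t z)
           + gibbs (h x t) (hg x t) *\<^sub>R gibbs (h x t) (gh x t)))"
    and "b_t \<equiv> (\<lambda>t. - mass_integral (\<lambda>x. deriv (p x) t) (\<lambda>x. gibbs (h x t) (gh x t)))"
  defines "th_lam \<equiv> (\<lambda>t. matrix_inv (A t) *v b_lam t)"
    and "th_gam \<equiv> (\<lambda>t. matrix_inv (A t) *v b_gam t)"
    and "th_t \<equiv> (\<lambda>t. matrix_inv (A t) *v b_t t)"
  assumes "ns > 0" and "nt > 0"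
    and "S \<subseteq> space MX" and "lab ` S \<subseteq> space MY"
    \<comment> \<open>the statistical model; \<open>U\<close> is a neighbourhood of the parameter set\<close>
    and "open U" and "\<Theta> \<subseteq> U"
    and "\<And>\<theta>. \<theta> \<in> U \<Longrightarrow> m \<theta> \<in> borel_measurable lborel"
    and "\<And>\<theta>. \<theta> \<in> U \<Longrightarrow> (\<lambda>(x, z). d \<theta> x z) \<in> borel_measurable (MX \<Otimes>\<^sub>M lborel)"
    and "\<And>\<theta>. \<theta> \<in> U \<Longrightarrow> (\<lambda>(y, z). c \<theta> y z) \<in> borel_measurable (MY \<Otimes>\<^sub>M lborel)"
    and "\<And>\<theta>. \<theta> \<in> \<Theta> \<Longrightarrow> prob_space (density lborel (\<lambda>z. ennreal (m \<theta> z)))"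
    and "\<And>\<theta> z. \<theta> \<in> \<Theta> \<Longrightarrow> prob_space (density MX (\<lambda>x. ennreal (d \<theta> x z)))"
    and "\<And>\<theta> z. \<theta> \<in> \<Theta> \<Longrightarrow> prob_space (density MY (\<lambda>y. ennreal (c \<theta> y z)))"
    and "\<And>\<theta> z. \<theta> \<in> U \<Longrightarrow> m \<theta> z > 0"
    and "\<And>\<theta> x z. \<theta> \<in> U \<Longrightarrow> x \<in> space MX \<Longrightarrow> d \<theta> x z > 0"
    and "\<And>\<theta> y z. \<theta> \<in> U \<Longrightarrow> y \<in> space MY \<Longrightarrow> c \<theta> y z > 0"
    and "\<And>z. smooth_on U (\<lambda>\<theta>. m \<theta> z)"
    and "\<And>x z. x \<in> space MX \<Longrightarrow> smooth_on U (\<lambda>\<theta>. d \<theta> x z)"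
    and "\<And>y z. y \<in> space MY \<Longrightarrow> smooth_on U (\<lambda>\<theta>. c \<theta> y z)"
    \<comment> \<open>finite partition functions and differentiation under the integral over \<open>z\<close>\<close>
    and "\<And>x \<theta> t. x \<in> S \<Longrightarrow> \<theta> \<in> \<Theta> \<Longrightarrow> t \<in> {0..1} \<Longrightarrow>
           integrable lborel (\<lambda>z. exp (- H x \<theta> (lam t) (gam t) z))"
    and "\<And>x t. x \<in> S \<Longrightarrow> t \<in> {0..1} \<Longrightarrow> locally_dominated H th lam gam x t"
    \<comment> \<open>the quasi-static path of equilibria\<close>
    and "smooth_on {0..1} lam" and "smooth_on {0..1} gam" and "smooth_on {0..1} th"
    and "\<And>t. t \<in> {0..1} \<Longrightarrow> th t \<in> equilibrium_set \<Theta> J (lam t) (gam t) t"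
    and "\<And>t. t \<in> {0..1} \<Longrightarrow>
           ((\<lambda>s. grad (\<lambda>\<theta>. J \<theta> (lam s) (gam s) s) (th s)) has_vector_derivative 0) (at t within {0..1})"
    and "\<And>t. t \<in> {0..1} \<Longrightarrow> invertible (A t)"
  shows "\<forall>t\<in>{0..1}.
           thdot t = lamdot t *\<^sub>R th_lam t + gamdot t *\<^sub>R th_gam t + th_t t \<and>
           th_t t = - (matrix_inv (A t) *v
             mass_integral (\<lambda>x. deriv (p x) t) (\<lambda>x. gibbs (h x t) (gh x t))) \<and>
           A t = mass_integral (\<lambda>x. p x t) (\<lambda>x.
               gibbs (h x t) (hh x t)
             + outer (gibbs (h x t) (gh x t)) (gibbs (h x t) (gh x t))
             - gibbs (h x t) (\<lambda>z. outer (gh x t z) (gh x t z)))"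
proof -
  note defs = assms(1-21)
  note ns = assms(22) and nt = assms(23) and SX = assms(24) and SY = assms(25) and U = assms(26) and \<Theta>U = assms(27)
  note meas = assms(28-30) and pos = assms(34-36) and smooth = assms(37-39)
  note dom = assms(41) and paths = assms(42-44) and equil = assms(45) and qs = assms(46) and inv = assms(47)
  have fin: "finite S" unfolding defs(2) by simp
  have p0: "{x. p x t \<noteq> 0} \<subseteq> S" "{x. pmf (empirical nt xt) x - pmf (empirical ns xs) x \<noteq> 0} \<subseteq> S" for t
  proof -
    have "pmf (empirical ns xs) x = 0" "pmf (empirical nt xt) x = 0" if "x \<notin> S" for x
      using that set_pmf_empirical[OF ns, of xs] set_pmf_empirical[OF nt, of xt]
      unfolding defs(2) pmf_eq_0_set_pmf by blast+
    then show "{x. p x t \<noteq> 0} \<subseteq> S" "{x. pmf (empirical nt xt) x - pmf (empirical ns xs) x \<noteq> 0} \<subseteq> S"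
      by (force simp: defs(1) data_mass_def)+
  qed
  note mass = mass_integral_finite_support[OF fin p0(1)]
  have pdot: "((\<lambda>s. p x s) has_field_derivative (pmf (empirical nt xt) x - pmf (empirical ns xs) x)) (at t within T)" for x t T
    unfolding defs(1) by (rule has_field_derivative_data_mass)
  have deriv_p: "deriv (p x) t = pmf (empirical nt xt) x - pmf (empirical ns xs) x" for x t
    using DERIV_imp_deriv[OF pdot] by simp
  have massd: "mass_integral (\<lambda>x. deriv (p x) t) f =
      (\<Sum>x\<in>S. (pmf (empirical nt xt) x - pmf (empirical ns xs) x) *\<^sub>R f x)" for t and f :: "'x \<Rightarrow> real^'n"
    unfolding deriv_p by (rule mass_integral_finite_support[OF fin p0(2)])
  have thU: "th t \<in> U" if "t \<in> {0..1}" for t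
    using equil[OF that] \<Theta>U by (auto simp: equilibrium_set_def is_arg_min_def)
  have aff: "affine_hamiltonian U H x (\<lambda>\<theta> z. - ln (m \<theta> z)) (\<lambda>\<theta> z. - ln (d \<theta> x z)) (\<lambda>\<theta> z. - ln (c \<theta> (lab x) z))"
    if x: "x \<in> S" for x
    unfolding defs(3)
  proof (rule affine_hamiltonian_hamiltonian[OF U meas(1)])
    have xs: "x \<in> space MX" "lab x \<in> space MY" using x SX SY by auto
    \<comment> \<open>Joint measurability restricts to the section at the fixed datum or
      label.\<close>
    show "d \<theta> x \<in> borel_measurable lborel" "c \<theta> (lab x) \<in> borel_measurable lborel" if "\<theta> \<in> U" for \<theta>
      using measurable_compose[OF measurable_Pair1'[OF xs(1)] meas(2)[OF that]]
        measurable_compose[OF measurable_Pair1'[OF xs(2)] meas(3)[OF that]] by auto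
  qed (use x SX SY pos smooth in auto)

  let ?Q = "\<lambda>x \<theta> t. gibbs (H x \<theta> (lam t) (gam t)) (grad_H H x \<theta> (lam t) (gam t))"
  \<comment> \<open>There are finitely many data, so their neighbourhoods of \<open>th t\<close> can
    be intersected. The minus in \<open>free_energy\<close> cancels the one from differentiating the
    logarithm of the partition function.\<close>
  have gradJ: "\<forall>\<^sub>F \<theta> in nhds (th t). grad (\<lambda>\<theta>. J \<theta> (lam t) (gam t) t) \<theta> = (\<Sum>x\<in>S. p x t *\<^sub>R ?Q x \<theta> t)"
    if t: "t \<in> {0..1}" for t
  proof -
    have "\<forall>\<^sub>F \<theta> in nhds (th t). \<forall>x\<in>S. ((\<lambda>\<theta>. ln (partition_fun (H x \<theta> (lam t) (gam t)))) has_derivative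
        (\<lambda>v. - (?Q x \<theta> t \<bullet> v))) (at \<theta>)"
      using affine_hamiltonian.has_derivative_gibbs_parameter(1)[OF aff thU[OF t] t dom[OF _ t]]
      by (intro eventually_ball_finite[OF fin]) auto
    then show ?thesis
    proof eventually_elim
      case (elim \<theta>)
      have "((\<lambda>\<theta>. J \<theta> (lam t) (gam t) t) has_derivative (\<lambda>v. (\<Sum>x\<in>S. p x t *\<^sub>R ?Q x \<theta> t) \<bullet> v)) (at \<theta>)"
        unfolding defs(4) free_energy_def mass
        by (rule has_derivative_eq_rhs, rule has_derivative_minus, rule has_derivative_sum,
            rule has_derivative_scaleR_right, rule bspec[OF elim], assumption)
          (simp add: inner_sum_left sum_negf)
      then show ?case by (rule grad_eqI)
    qed
  qed
  \<comment> \<open>The gradient formula is known only near \<open>th t\<close>, which suffices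
    because the Hessian is a derivative at that point.\<close>
  have A: "A t = (\<Sum>x\<in>S. p x t *\<^sub>R hess_datum_energy H x (th t) (lam t) (gam t))" if t: "t \<in> {0..1}" for t
    unfolding defs(15)
  proof (rule hessian_eqI, rule has_derivative_transform_eventually)
    show "((\<lambda>\<theta>. \<Sum>x\<in>S. p x t *\<^sub>R ?Q x \<theta> t) has_derivative
        (\<lambda>v. (\<Sum>x\<in>S. p x t *\<^sub>R hess_datum_energy H x (th t) (lam t) (gam t)) *v v)) (at (th t))"
      by (rule has_derivative_eq_rhs, rule has_derivative_sum, rule has_derivative_scaleR_right,
          rule affine_hamiltonian.has_derivative_gibbs_parameter(2)[OF aff thU[OF t] t dom[OF _ t]], assumption+)
        (simp add: fun_eq_iff linear_sum[OF bounded_linear.linear[OF bounded_linear_matrix_vector_mult_left]]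
          scaleR_matrix_vector_assoc)
    show "\<forall>\<^sub>F \<theta> in at (th t). (\<Sum>x\<in>S. p x t *\<^sub>R ?Q x \<theta> t) = grad (\<lambda>\<theta>. J \<theta> (lam t) (gam t) t) \<theta>"
      using gradJ[OF t] unfolding eventually_at_filter by eventually_elim simp
    show "(\<Sum>x\<in>S. p x t *\<^sub>R ?Q x (th t) t) = grad (\<lambda>\<theta>. J \<theta> (lam t) (gam t) t) (th t)"
      using eventually_nhds_x_imp_x[OF gradJ[OF t]] by simp
  qed simp
  have main: "A t *v thdot t = lamdot t *\<^sub>R b_lam t + gamdot t *\<^sub>R b_gam t + b_t t" if t: "t \<in> {0..1}" for t
  proof -
    let ?h = "\<lambda>x. H x (th t) (lam t) (gam t)" and ?gh = "\<lambda>x. grad_H H x (th t) (lam t) (gam t)"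
    let ?RL = "\<lambda>x. gibbs_response (?h x) (dlam H x (th t) (lam t) (gam t)) (dlam (grad_H H) x (th t) (lam t) (gam t)) (?gh x)"
    let ?RG = "\<lambda>x. gibbs_response (?h x) (dgam H x (th t) (lam t) (gam t)) (dgam (grad_H H) x (th t) (lam t) (gam t)) (?gh x)"
    let ?Q' = "\<lambda>x. hess_datum_energy H x (th t) (lam t) (gam t) *v thdot t + lamdot t *\<^sub>R ?RL x + gamdot t *\<^sub>R ?RG x"
    have Q': "((\<lambda>s. ?Q x (th s) s) has_vector_derivative ?Q' x) (at t within {0..1})" if x: "x \<in> S" for x
      unfolding defs(5-7)
      by (rule affine_hamiltonian.has_vector_derivative_gibbs_path[OF aff[OF x] t dom[OF x t]])
        (use thU smooth_on_unit_interval[OF paths(1)] smooth_on_unit_interval[OF paths(2)]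
          smooth_on_unit_interval[OF paths(3)] in auto)
    have expand: "(\<Sum>x\<in>S. q x *\<^sub>R (u x + \<alpha> *\<^sub>R v x + \<beta> *\<^sub>R w x) + r x *\<^sub>R y x)
        = (\<Sum>x\<in>S. q x *\<^sub>R u x) + \<alpha> *\<^sub>R (\<Sum>x\<in>S. q x *\<^sub>R v x) + \<beta> *\<^sub>R (\<Sum>x\<in>S. q x *\<^sub>R w x)
          + (\<Sum>x\<in>S. r x *\<^sub>R y x)"
      for q r :: "'x \<Rightarrow> real" and u v w y :: "'x \<Rightarrow> real^'n" and \<alpha> \<beta>
      by (simp add: sum.distrib scaleR_add_right scaleR_sum_right mult.commute)
    \<comment> \<open>The product rule: the first summand is the response of the Gibbs averages, the
      second comes from the moving data masses and becomes \<open>b_t\<close>.\<close>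
    have "((\<lambda>s. \<Sum>x\<in>S. p x s *\<^sub>R ?Q x (th s) s) has_vector_derivative
        (\<Sum>x\<in>S. p x t *\<^sub>R ?Q' x + (pmf (empirical nt xt) x - pmf (empirical ns xs) x) *\<^sub>R ?Q x (th t) t))
        (at t within {0..1})"
      by (intro has_vector_derivative_sum has_vector_derivative_scaleR pdot Q')
    \<comment> \<open>Each time \<open>s\<close> has its own neighbourhood in \<open>gradJ\<close>;
      only the value at its centre \<open>th s\<close> is taken, so no uniformity in
      \<open>s\<close> is required.\<close>
    moreover have "((\<lambda>s. \<Sum>x\<in>S. p x s *\<^sub>R ?Q x (th s) s) has_vector_derivative 0) (at t within {0..1})"
      by (rule has_vector_derivative_transform[OF t _ qs[OF t]])
        (use eventually_nhds_x_imp_x[OF gradJ] in simp)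
    \<comment> \<open>Both velocities are derivatives within the interval; they agree because every
      \<open>t\<close> in it, end points included, is a limit point.\<close>
    ultimately have "(\<Sum>x\<in>S. p x t *\<^sub>R ?Q' x + (pmf (empirical nt xt) x - pmf (empirical ns xs) x) *\<^sub>R ?Q x (th t) t) = 0"
      using t by (intro vector_derivative_unique_within[of t "{0..1}"]) (auto simp: trivial_limit_within)
    moreover have "A t *v thdot t = (\<Sum>x\<in>S. p x t *\<^sub>R (hess_datum_energy H x (th t) (lam t) (gam t) *v thdot t))"
      by (simp add: A[OF t] linear_sum[OF bounded_linear.linear[OF bounded_linear_matrix_vector_mult_left]]
          scaleR_matrix_vector_assoc)
    moreover have "b_lam t = - (\<Sum>x\<in>S. p x t *\<^sub>R ?RL x)" "b_gam t = - (\<Sum>x\<in>S. p x t *\<^sub>R ?RG x)"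
      unfolding defs(8-14,16,17) mass gibbs_response_def by simp_all
    moreover have "b_t t = - (\<Sum>x\<in>S. (pmf (empirical nt xt) x - pmf (empirical ns xs) x) *\<^sub>R ?Q x (th t) t)"
      unfolding defs(8,9,18) massd by simp
    ultimately show ?thesis
      unfolding expand by (simp add: add_eq_0_iff2 algebra_simps)
  qed
  show ?thesis
  proof (intro ballI conjI)
    fix t assume t: "t \<in> {0..1::real}"
    \<comment> \<open>\<open>matrix_inv\<close> is a choice among two-sided inverses; invertibility
      guarantees that the chosen matrix is one.\<close>
    have "thdot t = (matrix_inv (A t) ** A t) *v thdot t"
      using someI_ex[OF inv[OF t, unfolded invertible_def]] by (simp add: matrix_inv_def)
    also have "\<dots> = matrix_inv (A t) *v (lamdot t *\<^sub>R b_lam t + gamdot t *\<^sub>R b_gam t + b_t t)"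
      by (simp add: main[OF t] matrix_vector_mul_assoc[symmetric])
    finally show "thdot t = lamdot t *\<^sub>R th_lam t + gamdot t *\<^sub>R th_gam t + th_t t"
      by (simp add: defs(19-) matrix_vector_right_distrib matrix_vector_mult_scaleR)
    show "th_t t = - (matrix_inv (A t) *v
             mass_integral (\<lambda>x. deriv (p x) t) (\<lambda>x. gibbs (h x t) (gh x t)))"
      by (simp add: defs(18-21) linear_neg[OF matrix_vector_mul_linear])
    show "A t = mass_integral (\<lambda>x. p x t) (\<lambda>x.
               gibbs (h x t) (hh x t)
             + outer (gibbs (h x t) (gh x t)) (gibbs (h x t) (gh x t))
             - gibbs (h x t) (\<lambda>z. outer (gh x t z) (gh x t z)))"
      unfolding A[OF t] mass defs(8-10) hess_datum_energy_def ..
  qed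
qed

end
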